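(* Let $d\ge2$. For every $\delta>0$ there exist a function $f\in L^\infty(\mathbb{R}^d)$ with $f(0)=\|f\|_\infty=1$ and $\operatorname{supp}(\widehat f)\subset B(0,1)$, a function $\varphi$ with $\varphi(0)=1$, and a $\varphi$-regular set $\Gamma\subset\mathbb{R}^d$ with $\Gamma\subset\{f=0\}$, such that $$\mathbf{D}^-(\Gamma)>2\Big(\frac d2\,\frac{\omega_d}{\omega_{d-1}}-\delta\Big).$$
   Context: $m_d$ is Lebesgue measure on $\mathbb{R}^d$ and $\omega_k$ is the volume of the unit ball of $\mathbb{R}^k$; $B(0,1)$ is the closed Euclidean unit ball. The $k$-dimensional Hausdorff measure is normalized as $$\mathcal{H}^k(E)=\lim_{\delta\to0^+}\inf\Big\{\omega_k\sum_j r_j^k:\ E\subset\bigcup_j B(x_j,r_j),\ r_j\le\delta\Big\},$$ so that it equals $m_k$ on $k$-dimensional planes. The Fourier transform is $\widehat f(\xi)=\int_{\mathbb{R}^d}f(x)e^{2\pi i\langle x,\xi\rangle}\,dm_d(x)$, extended to tempered distributions. A bounded function whose distributional Fourier transform has compact support is identified with its continuous representative; $\{f=0\}=\{x\in\mathbb{R}^d: f(x)=0\}$. For a function $\varphi:[0,1)\to[0,\infty)$ continuous at $0$, a measure $\mu$ on $\mathbb{R}^d$ is $\varphi$-regular if $\mu(B(x,r))\le\varphi(r)\,\omega_{d-1}r^{d-1}$ for all $x\in\mathbb{R}^d$ and $r\in(0,1)$. A closed set $E\subset\mathbb{R}^d$ is $\varphi$-regular if the measure $\mathcal{H}^{d-1}|_E$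 is $\varphi$-regular. The lower surface density of $\Gamma\subset\mathbb{R}^d$ is $$\mathbf{D}^-(\Gamma)=\liminf_{r\to\infty}\inf_{x\in\mathbb{R}^d}\frac{\mathcal{H}^{d-1}(\Gamma\cap B(x,r))}{m_d(B(x,r))}.$$ *)

theory Defs
  imports "HOL-Analysis.Analysis" "HOL-Probability.Essential_Supremum"
begin

section \<open>Hausdorff measure\<close>

text \<open>The covers are indexed by an arbitrary \<open>J \<subseteq> \<nat>\<close>, so finite covers are included.\<close>

definition hausdorff_pre :: "nat \<Rightarrow> real \<Rightarrow> 'a::euclidean_space set \<Rightarrow> ennreal" where
  "hausdorff_pre k \<delta> E =
     (INF (J, x, r) \<in> {(J :: nat set, x :: nat \<Rightarrow> 'a, r :: nat \<Rightarrow> real).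
          (\<forall>j\<in>J. 0 < r j \<and> r j \<le> \<delta>) \<and> E \<subseteq> (\<Union>j\<in>J. cball (x j) (r j))}.
        ennreal (unit_ball_vol (real k)) * (\<Sum>\<^sub>\<infinity>j\<in>J. ennreal (r j ^ k)))"

definition hausdorff_meas :: "nat \<Rightarrow> 'a::euclidean_space set \<Rightarrow> ennreal" where
  "hausdorff_meas k E = Lim (at_right 0) (\<lambda>\<delta>. hausdorff_pre k \<delta> E)"

lemma hausdorff_pre_antimono:
  assumes "\<delta> \<le> \<delta>'"
  shows "hausdorff_pre k \<delta>' E \<le> hausdorff_pre k \<delta> E"
  unfolding hausdorff_pre_def
proof (rule INF_superset_mono)
  show "{(J, x, r). (\<forall>j\<in>J. 0 < r j \<and> r j \<le> \<delta>) \<and> E \<subseteq> (\<Union>j\<in>J. cball (x j) (r j))}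
      \<subseteq> {(J, x, r). (\<forall>j\<in>J. 0 < r j \<and> r j \<le> \<delta>') \<and> E \<subseteq> (\<Union>j\<in>J. cball (x j) (r j))}"
    by (intro Collect_mono case_prodI2 impI) (use assms in \<open>blast intro: order_trans\<close>)
qed simp

text \<open>The limit in the definition always exists.\<close>

lemma hausdorff_pre_tendsto:
  "((\<lambda>\<delta>. hausdorff_pre k \<delta> E) \<longlongrightarrow> (SUP \<delta>\<in>{0<..}. hausdorff_pre k \<delta> E)) (at_right 0)"
proof (rule order_tendstoI)
  fix a assume "a < (SUP \<delta>\<in>{0<..}. hausdorff_pre k \<delta> E)"
  then obtain e where e: "e > 0" "a < hausdorff_pre k e E"
    by (auto simp: less_SUP_iff)
  have "a < hausdorff_pre k \<delta> E" if "0 < \<delta>" "\<delta> < e" for \<delta>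
    using e(2) hausdorff_pre_antimono[of \<delta> e k E] that by (meson less_imp_le less_le_trans)
  then show "\<forall>\<^sub>F \<delta> in at_right 0. a < hausdorff_pre k \<delta> E"
    unfolding eventually_at_right_field using e(1) by blast
next
  fix a assume *: "(SUP \<delta>\<in>{0<..}. hausdorff_pre k \<delta> E) < a"
  have "hausdorff_pre k \<delta> E < a" if "0 < \<delta>" for \<delta>
    by (rule le_less_trans[OF SUP_upper *]) (use that in simp)
  then show "\<forall>\<^sub>F \<delta> in at_right 0. hausdorff_pre k \<delta> E < a"
    unfolding eventually_at_right_field by (intro exI[of _ 1]) simp
qed

lemma hausdorff_meas_eq_SUP: "hausdorff_meas k E = (SUP \<delta>\<in>{0<..}. hausdorff_pre k \<delta> E)"
  unfolding hausdorff_meas_def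
  by (rule tendsto_Lim[OF trivial_limit_at_right_real hausdorff_pre_tendsto])

section \<open>Regular sets and lower surface density\<close>

text \<open>Only the values on closed balls enter the definition of regularity, so a measure is
  represented by its set function.\<close>

definition regular_meas :: "(real \<Rightarrow> real) \<Rightarrow> ('a::euclidean_space set \<Rightarrow> ennreal) \<Rightarrow> bool" where
  "regular_meas \<phi> \<mu> \<longleftrightarrow>
     (\<forall>x. \<forall>r\<in>{0<..<1}. \<mu> (cball x r)
        \<le> ennreal (\<phi> r * unit_ball_vol (real (DIM('a) - 1)) * r ^ (DIM('a) - 1)))"

definition regular_set :: "(real \<Rightarrow> real) \<Rightarrow> 'a::euclidean_space set \<Rightarrow> bool" where
  "regular_set \<phi> E \<longleftrightarrow>
     closed E \<and> regular_meas \<phi> (\<lambda>A. hausdorff_meas (DIM('a) - 1) (E \<inter> A))"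

definition lower_surface_density :: "'a::euclidean_space set \<Rightarrow> ennreal" where
  "lower_surface_density \<Gamma> =
     Liminf at_top (\<lambda>r::real.
       INF x. hausdorff_meas (DIM('a) - 1) (\<Gamma> \<inter> cball x r) / emeasure lborel (cball x r))"

section \<open>Bounded functions and the distributional Fourier transform\<close>

definition Linf_norm :: "('a::euclidean_space \<Rightarrow> complex) \<Rightarrow> ereal" where
  "Linf_norm f = esssup lborel (\<lambda>x. ereal (cmod (f x)))"

definition Linf :: "('a::euclidean_space \<Rightarrow> complex) set" where
  "Linf = {f \<in> borel_measurable lborel. Linf_norm f < \<infinity>}"

fun partials :: "'a::euclidean_space list \<Rightarrow> ('a \<Rightarrow> complex) \<Rightarrow> 'a \<Rightarrow> complex" where
  "partials [] \<psi> = \<psi>"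
| "partials (b # bs) \<psi> = (\<lambda>x. frechet_derivative (partials bs \<psi>) (at x) b)"

definition smooth :: "('a::euclidean_space \<Rightarrow> complex) \<Rightarrow> bool" where
  "smooth \<psi> \<longleftrightarrow> (\<forall>bs\<in>lists Basis. \<forall>x. partials bs \<psi> differentiable at x)"

definition schwartz :: "('a::euclidean_space \<Rightarrow> complex) \<Rightarrow> bool" where
  "schwartz \<psi> \<longleftrightarrow> smooth \<psi> \<and>
     (\<forall>bs\<in>lists Basis. \<forall>N::nat. bounded (range (\<lambda>x. norm x ^ N *\<^sub>R partials bs \<psi> x)))"

definition fourier :: "('a::euclidean_space \<Rightarrow> complex) \<Rightarrow> 'a \<Rightarrow> complex" where
  "fourier f \<xi> = (LINT x|lborel. f x * exp (2 * of_real pi * \<i> * of_real (x \<bullet> \<xi>)))"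

text \<open>Tempered distributions are represented by functionals whose values matter only on
  Schwartz functions.\<close>

type_synonym 'a distr = "('a \<Rightarrow> complex) \<Rightarrow> complex"

definition distr_of :: "('a::euclidean_space \<Rightarrow> complex) \<Rightarrow> 'a distr" where
  "distr_of f \<psi> = (LINT x|lborel. f x * \<psi> x)"

definition distr_fourier :: "'a::euclidean_space distr \<Rightarrow> 'a distr" where
  "distr_fourier T \<psi> = T (fourier \<psi>)"

definition distr_vanishes_on :: "'a::euclidean_space distr \<Rightarrow> 'a set \<Rightarrow> bool" where
  "distr_vanishes_on T U \<longleftrightarrow>
     (\<forall>\<psi>. schwartz \<psi> \<and> compact (closure {x. \<psi> x \<noteq> 0}) \<and> closure {x. \<psi> x \<noteq> 0} \<subseteq> U
        \<longrightarrow> T \<psi> = 0)"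

definition distr_support :: "'a::euclidean_space distr \<Rightarrow> 'a set" where
  "distr_support T = - \<Union>{U. open U \<and> distr_vanishes_on T U}"

end

(*
  A family of parallel hyperplanes orthogonal to v and at distance 1/|v| from each other is the
  zero set of cos(pi <x,v>) and has surface density |v|. For finitely many pairwise nonparallel
  vectors v, the product f of these cosines has its frequencies in the zonotope of the sums
  (1/2) (sum +-v), which lies in the unit ball as soon as sum |<v,u>| <= 2|u| for all u.
  Discretising Lebesgue measure on the unit ball into point masses gives such vectors with sum |v|
  as close as desired to 2 int |x| dx / int |x_1| dx = d omega_d / omega_(d-1).

  At the intersections of the hyperplanes regularity with phi(0) = 1 fails. So Gamma is
  obtained by cutting out of each hyperplane the eps-neighbourhoods of those of the other
  directions: the remaining pieces have distance at least eps/2 from each other, hence small balls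
  meet only one of them, and by averaging over translations within a hyperplane the loss of
  density is O(eps), uniformly in the ball.
*)
theory Submission
  imports Defs "HOL-Probability.Characteristic_Functions"
begin

text \<open>The slack 2 \<delta> in the bound is spent twice. The directions come first and use part
  of it. Their number is not controlled, but cutting costs at most 6 \<epsilon> card V times the
  total length of the vectors, so \<epsilon> is chosen afterwards. The averaging gives this for
  arbitrary nonparallel directions, with no commensurability or equidistribution of the families.

  Hausdorff measure enters through two one-sided estimates, both with the sharp constant. From
  above, a (d-1)-ball is filled up to a null set by disjoint small balls, which gives \<phi>(0) = 1.
  From below, a piece of a hyperplane is weighed by the slab of points nearest to it, and a small
  ball gets weight at most \<omega>_(d-1) r^(d-1). As the coverings consist of balls, this suffices,
  and the density becomes a matter of volumes in large balls.

  For the spectrum, the obstacle is an exchange of integrals in which the Fourier transform of a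
  test function is not known to be integrable; Gaussian cut-offs make it legitimate.\<close>

section \<open>Lebesgue measure\<close>

text \<open>Uniqueness of Haar measure: by Fubini and the translation invariance of both measures,
  the value of \<open>\<integral>\<integral> 1\<^sub>A(x) 1\<^sub>B(y)\<close> does not change when the two measures are exchanged; for
  the unit ball \<open>B\<close> both measures agree.\<close>

lemma lborel_distr_linear_isometry:
  fixes T :: "'c::euclidean_space \<Rightarrow> 'a::euclidean_space"
  assumes lin: "linear T" and iso: "\<And>x. norm (T x) = norm x" and dim: "DIM('c) = DIM('a)"
  shows "distr lborel borel T = (lborel :: 'a measure)"
proof (rule measure_eqI)
  show "sets (distr lborel borel T) = sets (lborel :: 'a measure)" by simp
next
  have surj: "surj T"
  proof -
    have "inj T" using lin iso by (metis linear_injective_0 norm_eq_zero)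
    then have "dim (range T) = DIM('c)"
      using dim_image_eq[of T UNIV] lin by (simp add: dim_UNIV)
    then have "range T = span (range T)" "dim (range T) = DIM('a)"
      using lin dim by (simp_all add: span_linear_image)
    then show ?thesis
      by (metis dim_eq_full)
  qed
  have Tm[measurable]: "T \<in> borel_measurable borel"
    using lin by (intro borel_measurable_continuous_onI linear_continuous_on linear_conv_bounded_linear[THEN iffD1])
  let ?N = "distr lborel borel T"
  let ?B = "cball 0 1 :: 'a set"
  have B[measurable]: "?B \<in> sets borel" by simp
  interpret N: sigma_finite_measure ?N
  proof
    show "\<exists>A. countable A \<and> A \<subseteq> sets ?N \<and> \<Union> A = space ?N \<and> (\<forall>a\<in>A. emeasure ?N a \<noteq> \<infinity>)"
    proof (intro exI[of _ "range (\<lambda>n::nat. cball 0 (real n))"] conjI ballI)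
      show "\<Union> (range (\<lambda>n::nat. cball 0 (real n))) = space ?N"
        by (auto simp: real_arch_simple)
      fix a assume "a \<in> range (\<lambda>n::nat. cball (0::'a) (real n))"
      then obtain n where a: "a = cball 0 (real n)" by auto
      have "emeasure ?N a = emeasure lborel (cball (0::'c) (real n))"
        by (subst emeasure_distr) (auto simp: a iso vimage_def intro!: arg_cong[where f="emeasure lborel"])
      then show "emeasure ?N a \<noteq> \<infinity>" using emeasure_lborel_cball_finite[of 0 "real n"] by (metis infinity_ennreal_def less_irrefl)
    qed auto
  qed
  interpret L: sigma_finite_measure "lborel :: 'a measure" by (rule sigma_finite_lborel)
  interpret P: pair_sigma_finite "lborel :: 'a measure" ?N ..
  interpret Q: pair_sigma_finite ?N "lborel :: 'a measure" ..
  \<comment> \<open>The volume of a unit ball depends on the dimension alone; this fixes the factor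
    that translation invariance leaves open.\<close>
  have NB: "emeasure ?N ?B = emeasure lborel ?B"
  proof -
    have "emeasure ?N ?B = emeasure lborel (cball (0::'c) 1)"
      by (subst emeasure_distr) (auto simp: iso vimage_def intro!: arg_cong[where f="emeasure lborel"])
    then show ?thesis by (simp add: emeasure_cball dim)
  qed
  have Ltr: "(\<integral>\<^sup>+x. g x \<partial>lborel) = (\<integral>\<^sup>+x. g (x + y) \<partial>lborel)"
    if [measurable]: "g \<in> borel_measurable borel" for g and y :: "'b::euclidean_space"
  proof -
    have "(\<integral>\<^sup>+x. g (x + y) \<partial>lborel) = (\<integral>\<^sup>+x. g x \<partial>distr lborel borel ((+) y))"
      by (subst nn_integral_distr) (auto simp: add.commute)
    then show ?thesis by (simp add: lborel_distr_plus)
  qed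
  have Ntr: "(\<integral>\<^sup>+x. g x \<partial>?N) = (\<integral>\<^sup>+x. g (x + y) \<partial>?N)"
    if [measurable]: "g \<in> borel_measurable borel" for g y
  proof -
    obtain c where c: "y = T c" using surj by (metis surjD)
    have "(\<integral>\<^sup>+x. g x \<partial>?N) = (\<integral>\<^sup>+x. g (T x) \<partial>lborel)" by (subst nn_integral_distr) auto
    also have "\<dots> = (\<integral>\<^sup>+x. g (T (x + c)) \<partial>lborel)" by (rule Ltr) measurable
    also have "\<dots> = (\<integral>\<^sup>+x. g (x + y) \<partial>?N)"
      by (subst nn_integral_distr) (auto simp: c linear_add[OF lin])
    finally show ?thesis .
  qed
  fix A assume "A \<in> sets ?N"
  then have A[measurable]: "A \<in> sets borel" by simp
  have "emeasure lborel A * emeasure ?N ?B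
      = (\<integral>\<^sup>+x. \<integral>\<^sup>+y. indicator A x * indicator ?B y \<partial>?N \<partial>lborel)"
    by (simp add: nn_integral_cmult_indicator nn_integral_multc)
  also have "\<dots> = (\<integral>\<^sup>+y. \<integral>\<^sup>+x. indicator A x * indicator ?B y \<partial>lborel \<partial>?N)"
    by (rule P.Fubini'[symmetric]) measurable
  also have "\<dots> = (\<integral>\<^sup>+y. \<integral>\<^sup>+x. indicator A (x + y) * indicator ?B y \<partial>lborel \<partial>?N)"
    by (intro nn_integral_cong Ltr) measurable
  also have "\<dots> = (\<integral>\<^sup>+x. \<integral>\<^sup>+y. indicator A (x + y) * indicator ?B y \<partial>?N \<partial>lborel)"
    by (rule P.Fubini') measurable
  \<comment> \<open>The substitution of y - x for y makes the integrand 1_A(y) 1_B(y - x); by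
    symmetry of the ball, its integral over x is the volume of the unit ball about y.\<close>
  also have "\<dots> = (\<integral>\<^sup>+x. \<integral>\<^sup>+y. indicator A (x + (y + - x)) * indicator ?B (y + - x) \<partial>?N \<partial>lborel)"
    by (intro nn_integral_cong Ntr) measurable
  also have "\<dots> = (\<integral>\<^sup>+y. \<integral>\<^sup>+x. indicator A y * indicator ?B (y + - x) \<partial>lborel \<partial>?N)"
    by (subst P.Fubini'[symmetric]) (simp_all, measurable)
  also have "\<dots> = (\<integral>\<^sup>+y. indicator A y * emeasure lborel ?B \<partial>?N)"
  proof (intro nn_integral_cong)
    fix y :: 'a
    have "(\<integral>\<^sup>+x. indicator A y * indicator ?B (y + - x) \<partial>lborel)
        = indicator A y * (\<integral>\<^sup>+x. indicator (cball y 1) x \<partial>lborel)"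
      by (subst nn_integral_cmult[symmetric])
         (auto intro!: borel_measurable_indicator nn_integral_cong simp: indicator_def dist_norm norm_minus_commute)
    then show "(\<integral>\<^sup>+x. indicator A y * indicator ?B (y + - x) \<partial>lborel) = indicator A y * emeasure lborel ?B"
      by (simp add: emeasure_cball)
  qed
  also have "\<dots> = emeasure ?N A * emeasure lborel ?B"
    by (simp add: nn_integral_multc)
  finally have "emeasure lborel ?B * emeasure lborel A = emeasure lborel ?B * emeasure ?N A"
    by (simp add: NB mult.commute)
  moreover have "emeasure lborel ?B \<noteq> 0" "emeasure lborel ?B \<noteq> \<infinity>"
    by (simp_all add: emeasure_cball ennreal_eq_0_iff not_le)
  ultimately show "emeasure ?N A = emeasure lborel A"
    by (simp add: ennreal_mult_cancel_left)
qed

section \<open>Orthonormal coordinates adapted to a direction\<close>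

lemma orthogonal_complement_isometry:
  fixes \<theta> :: "'a::euclidean_space"
  assumes "\<theta> \<noteq> 0" and "DIM('b::euclidean_space) + 1 = DIM('a)"
  obtains L :: "'b::euclidean_space \<Rightarrow> 'a" where "linear L" "\<And>z. norm (L z) = norm z" "range L = {y. \<theta> \<bullet> y = 0}"
proof -
  have "dim (UNIV :: 'b set) = dim {y. \<theta> \<bullet> y = 0}"
    using assms by (simp add: dim_hyperplane)
  then obtain f :: "'b \<Rightarrow> 'a" and g where "linear f" "f ` UNIV = {y. \<theta> \<bullet> y = 0}" "\<And>x. x \<in> UNIV \<Longrightarrow> norm (f x) = norm x"
    using isometries_subspaces[OF subspace_UNIV subspace_hyperplane] by metis
  then show ?thesis using that by auto
qed

text \<open>Fubini in the coordinates (height along \<theta>, point of the orthogonal hyperplane).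
  The type \<open>'b\<close> stands for R^(d-1) throughout, so that (d-1)-dimensional volume can be
  expressed by Lebesgue measure on it.\<close>

lemma lborel_slice_isometry:
  fixes \<theta> :: "'a::euclidean_space"
  assumes "norm \<theta> = 1" and "DIM('b::euclidean_space) + 1 = DIM('a)"
  obtains T :: "real \<times> 'b::euclidean_space \<Rightarrow> 'a" where "T \<in> borel_measurable borel" "\<And>p. norm (T p) = norm p"
    "\<And>p. T p \<bullet> \<theta> = fst p" "\<And>p. norm (T p - (T p \<bullet> \<theta>) *\<^sub>R \<theta>) = norm (snd p)"
    "lborel = distr (lborel \<Otimes>\<^sub>M lborel) borel T"
proof -
  have "\<theta> \<noteq> 0" using assms by auto
  from orthogonal_complement_isometry[OF this assms(2)]
  obtain L :: "'b \<Rightarrow> 'a" where L: "linear L" "\<And>z. norm (L z) = norm z" "range L = {y. \<theta> \<bullet> y = 0}" by metis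
  have orth: "\<theta> \<bullet> L z = 0" "L z \<bullet> \<theta> = 0" for z using L(3) by (auto simp: inner_commute)
  have tt: "\<theta> \<bullet> \<theta> = 1" using assms(1) by (simp add: norm_eq_1)
  define T where "T = (\<lambda>p::real \<times> 'b. fst p *\<^sub>R \<theta> + L (snd p))"
  have lin: "linear T" unfolding T_def
    by (intro linearI) (simp_all add: linear_add[OF L(1)] linear_scale[OF L(1)] algebra_simps)
  have iso: "norm (T p) = norm p" for p
  proof -
    have "T p \<bullet> T p = (fst p)\<^sup>2 + L (snd p) \<bullet> L (snd p)"
      by (simp add: T_def inner_add_left inner_add_right orth tt power2_eq_square)
    also have "L (snd p) \<bullet> L (snd p) = snd p \<bullet> snd p" by (simp add: dot_square_norm L(2))
    also have "(fst p)\<^sup>2 + snd p \<bullet> snd p = p \<bullet> p" by (simp add: inner_prod_def power2_eq_square)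
    finally show ?thesis by (simp add: norm_eq)
  qed
  have inn: "T p \<bullet> \<theta> = fst p" for p by (simp add: T_def inner_add_left orth tt)
  show ?thesis
  proof
    show "T \<in> borel_measurable borel"
      using lin by (intro borel_measurable_continuous_onI linear_continuous_on linear_conv_bounded_linear[THEN iffD1])
    show "norm (T p - (T p \<bullet> \<theta>) *\<^sub>R \<theta>) = norm (snd p)" for p
      unfolding inn by (simp add: T_def L(2))
    show "lborel = distr (lborel \<Otimes>\<^sub>M lborel) borel T"
      using lborel_distr_linear_isometry[OF lin iso] assms(2) by (simp add: lborel_prod)
  qed (use iso inn in auto)
qed

text \<open>In adapted coordinates this set is an interval times a ball. Only the axis passes
  through \<open>y\<close>; the heights \<open>a\<close> and \<open>b\<close> are absolute, as
  needed for slabs between fixed parallel hyperplanes.\<close>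

lemma emeasure_lborel_cylinder:
  fixes \<theta> y :: "'a::euclidean_space"
  assumes "norm \<theta> = 1" and dim: "DIM('b::euclidean_space) + 1 = DIM('a)" and "a \<le> b" "0 \<le> s"
  shows "emeasure lborel {x. x \<bullet> \<theta> \<in> {a..b} \<and> norm ((x - y) - ((x - y) \<bullet> \<theta>) *\<^sub>R \<theta>) \<le> s}
    = ennreal ((b - a) * (unit_ball_vol (real DIM('b)) * s ^ DIM('b)))"
proof -
  obtain T :: "real \<times> 'b \<Rightarrow> 'a" where T[measurable]: "T \<in> borel_measurable borel"
    and inn: "\<And>p. T p \<bullet> \<theta> = fst p" and perp: "\<And>p. norm (T p - (T p \<bullet> \<theta>) *\<^sub>R \<theta>) = norm (snd p)"
    and eq: "lborel = distr (lborel \<Otimes>\<^sub>M lborel) borel T"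
    using lborel_slice_isometry[OF assms(1) dim] by metis
  have [measurable]: "T \<in> borel_measurable (lborel \<Otimes>\<^sub>M lborel)"
    using T by (simp add: lborel_prod)
  define C where "C = {x. x + y \<in> {x. x \<bullet> \<theta> \<in> {a..b} \<and> norm ((x - y) - ((x - y) \<bullet> \<theta>) *\<^sub>R \<theta>) \<le> s}}"
  have C: "C = {x. x \<bullet> \<theta> \<in> {a - y \<bullet> \<theta>..b - y \<bullet> \<theta>} \<and> norm (x - (x \<bullet> \<theta>) *\<^sub>R \<theta>) \<le> s}"
    by (auto simp: C_def inner_add_left)
  have [measurable]: "C \<in> sets borel" unfolding C by measurable
  have "emeasure lborel {x. x \<bullet> \<theta> \<in> {a..b} \<and> norm ((x - y) - ((x - y) \<bullet> \<theta>) *\<^sub>R \<theta>) \<le> s}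
      = emeasure (distr lborel borel ((+) y)) {x. x \<bullet> \<theta> \<in> {a..b} \<and> norm ((x - y) - ((x - y) \<bullet> \<theta>) *\<^sub>R \<theta>) \<le> s}"
    by (simp add: lborel_distr_plus)
  also have "\<dots> = emeasure lborel C"
    by (subst emeasure_distr) (auto simp: C_def vimage_def add.commute)
  also have "\<dots> = emeasure (lborel \<Otimes>\<^sub>M lborel) (T -` C \<inter> space (lborel \<Otimes>\<^sub>M lborel))"
    by (subst eq, subst emeasure_distr) auto
  also have "T -` C \<inter> space (lborel \<Otimes>\<^sub>M lborel) = {a - y \<bullet> \<theta>..b - y \<bullet> \<theta>} \<times> cball 0 s"
    using perp by (auto simp: C inn space_pair_measure)
  also have "emeasure (lborel \<Otimes>\<^sub>M lborel) \<dots> = ennreal (b - a) * ennreal (unit_ball_vol (real DIM('b)) * s ^ DIM('b))"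
    using assms(3,4) by (subst lborel.emeasure_pair_measure_Times) (auto simp: emeasure_cball)
  finally show ?thesis using assms(3,4) by (simp add: ennreal_mult)
qed

section \<open>First moments of the unit ball\<close>

lemma nn_integral_cball_norm:
  "(\<integral>\<^sup>+x\<in>cball 0 1. ennreal (norm x) \<partial>(lborel :: 'a::euclidean_space measure))
    = ennreal (real DIM('a) / (real DIM('a) + 1) * unit_ball_vol (real DIM('a)))"
proof -
  let ?\<omega> = "unit_ball_vol (real DIM('a))" let ?d = "DIM('a)"
  have [measurable]: "cball (0::'a) 1 \<in> sets borel" by simp
  have deriv: "((\<lambda>s. ?\<omega> * (s - s ^ Suc ?d / real (Suc ?d))) has_real_derivative ?\<omega> * (1 - s ^ ?d)) (at s)" for s
    by (rule derivative_eq_intros refl | simp del: of_nat_Suc power_Suc)+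
  \<comment> \<open>Layer cake: the norm is the length of [0, |x|), and exchanging the integrals
    leaves \<omega> times the integral of 1 - s^d over [0, 1].\<close>
  have "(\<integral>\<^sup>+x\<in>cball 0 1. ennreal (norm x) \<partial>(lborel :: 'a measure))
     = (\<integral>\<^sup>+x. \<integral>\<^sup>+s. indicator (cball 0 1) x * indicator {s. 0 \<le> s \<and> s < norm x} s \<partial>lborel \<partial>(lborel :: 'a measure))"
  proof (intro nn_integral_cong)
    fix x :: 'a
    have "{s. 0 \<le> s \<and> s < norm x} = {0..<norm x}" by auto
    then show "ennreal (norm x) * indicator (cball 0 1) x
        = (\<integral>\<^sup>+s. indicator (cball 0 1) x * indicator {s. 0 \<le> s \<and> s < norm x} s \<partial>lborel)"
      by (simp add: nn_integral_cmult mult.commute)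
  qed
  also have "\<dots> = (\<integral>\<^sup>+s. \<integral>\<^sup>+x. indicator (cball 0 1) x * indicator {s. 0 \<le> s \<and> s < norm x} s \<partial>(lborel :: 'a measure) \<partial>lborel)"
    by (rule lborel_pair.Fubini'[symmetric]) measurable
  also have "\<dots> = (\<integral>\<^sup>+s. ennreal (?\<omega> * (1 - s ^ ?d)) * indicator {0..1} s \<partial>lborel)"
  proof (intro nn_integral_cong)
    fix s :: real
    show "(\<integral>\<^sup>+x. indicator (cball 0 1) x * indicator {s. 0 \<le> s \<and> s < norm x} s \<partial>(lborel :: 'a measure))
       = ennreal (?\<omega> * (1 - s ^ ?d)) * indicator {0..1} s"
    proof (cases "s \<in> {0..1}")
      case True
      have "(\<integral>\<^sup>+x. indicator (cball 0 1) x * indicator {s. 0 \<le> s \<and> s < norm x} s \<partial>(lborel :: 'a measure))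
         = (\<integral>\<^sup>+x. indicator (cball 0 1 - cball 0 s) x \<partial>(lborel :: 'a measure))"
        using True by (intro nn_integral_cong) (auto simp: indicator_def)
      also have "\<dots> = emeasure lborel (cball 0 1 :: 'a set) - emeasure lborel (cball 0 s :: 'a set)"
        using True emeasure_Diff[of lborel "cball 0 s :: 'a set" "cball 0 1"] subset_cball[of s 1 "0::'a"]
        by (auto simp: emeasure_cball)
      also have "\<dots> = ennreal (?\<omega> * (1 - s ^ ?d))"
        using True by (simp add: emeasure_cball ennreal_minus algebra_simps)
      finally show ?thesis using True by simp
    next
      case False
      then have "(\<integral>\<^sup>+x. indicator (cball 0 1) x * indicator {s. 0 \<le> s \<and> s < norm x} s \<partial>(lborel :: 'a measure)) = (\<integral>\<^sup>+x. 0 \<partial>(lborel :: 'a measure))"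
        by (intro nn_integral_cong) (auto simp: indicator_def)
      then show ?thesis using False by simp
    qed
  qed
  also have "\<dots> = ennreal (?\<omega> * (1 - 1 ^ Suc ?d / real (Suc ?d)) - ?\<omega> * (0 - 0 ^ Suc ?d / real (Suc ?d)))"
    by (intro nn_integral_FTC_Icc deriv) (auto intro!: mult_nonneg_nonneg simp: power_le_one)
  also have "?\<omega> * (1 - 1 ^ Suc ?d / real (Suc ?d)) - ?\<omega> * (0 - 0 ^ Suc ?d / real (Suc ?d)) = real ?d / (real ?d + 1) * ?\<omega>"
    by (simp add: field_simps)
  finally show ?thesis .
qed

lemma set_nn_integral_has_integral:
  fixes f :: "real \<Rightarrow> real"
  assumes "(f has_integral I) {a..b}" and [measurable]: "f \<in> borel_measurable borel"
    and "\<And>x. x \<in> {a..b} \<Longrightarrow> 0 \<le> f x"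
  shows "(\<integral>\<^sup>+x\<in>{a..b}. ennreal (f x) \<partial>lborel) = ennreal I"
proof -
  have "((\<lambda>x. if x \<in> {a..b} then f x else 0) has_integral I) UNIV"
    using assms(1) by (subst has_integral_restrict_UNIV)
  then have "(\<integral>\<^sup>+x. ennreal (if x \<in> {a..b} then f x else 0) \<partial>lborel) = ennreal I"
    using assms(3) by (intro nn_integral_has_integral_lborel) auto
  then show ?thesis
    by (simp add: indicator_def of_bool_def if_distrib cong: if_cong)
qed

text \<open>For unit \<open>u\<close>, the slice at height t is a ball of radius sqrt (1 - t^2) in
  dimension d - 1, and t sqrt (1 - t^2)^(d-1) has an elementary primitive. That the value depends on
  \<open>norm u\<close> only is what makes a discretised sum of |<v,u>| nearly proportional to
  \<open>norm u\<close>.\<close>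

lemma nn_integral_cball_inner:
  fixes u :: "'a::euclidean_space"
  assumes dim: "DIM('b::euclidean_space) + 1 = DIM('a)"
  shows "(\<integral>\<^sup>+x\<in>cball 0 1. ennreal \<bar>x \<bullet> u\<bar> \<partial>lborel)
    = ennreal (2 / (real DIM('a) + 1) * unit_ball_vol (real DIM('b)) * norm u)"
proof (cases "u = 0")
  case False
  let ?\<omega> = "unit_ball_vol (real DIM('b))" let ?k = "DIM('b)"
  define \<theta> where "\<theta> = u /\<^sub>R norm u"
  have th: "norm \<theta> = 1" "u = norm u *\<^sub>R \<theta>" using False by (simp_all add: \<theta>_def)
  obtain T :: "real \<times> 'b \<Rightarrow> 'a" where T[measurable]: "T \<in> borel_measurable borel"
    and nrm: "\<And>p. norm (T p) = norm p"
    and inn: "\<And>p. T p \<bullet> \<theta> = fst p"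
    and eq: "lborel = distr (lborel \<Otimes>\<^sub>M lborel) borel T"
    using lborel_slice_isometry[OF th(1) dim] by metis
  have [measurable]: "T \<in> borel_measurable (lborel \<Otimes>\<^sub>M lborel)"
    using T by (simp add: lborel_prod)
  have [measurable]: "cball 0 1 \<in> sets (lborel \<Otimes>\<^sub>M (lborel :: 'b measure))"
    unfolding lborel_prod by simp
  have "(\<integral>\<^sup>+x\<in>cball 0 1. ennreal \<bar>x \<bullet> \<theta>\<bar> \<partial>lborel) =
    (\<integral>\<^sup>+p. ennreal \<bar>fst p\<bar> * indicator (cball 0 1) p \<partial>(lborel \<Otimes>\<^sub>M (lborel :: 'b measure)))"
    by (subst eq, subst nn_integral_distr) (auto simp: inn nrm indicator_def)
  also have "\<dots> = (\<integral>\<^sup>+t. \<integral>\<^sup>+z. ennreal \<bar>t\<bar> * indicator (cball 0 1) (t, z) \<partial>(lborel :: 'b measure) \<partial>lborel)"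
    by (subst lborel.nn_integral_fst[symmetric]) (simp_all, measurable)
  also have "\<dots> = (\<integral>\<^sup>+t. ennreal (\<bar>t\<bar> * (?\<omega> * sqrt (1 - t\<^sup>2) ^ ?k)) * indicator {-1..1} t \<partial>lborel)"
  proof (intro nn_integral_cong)
    fix t :: real
    have iff: "(t, z) \<in> cball 0 1 \<longleftrightarrow> t \<in> {-1..1} \<and> z \<in> cball 0 (sqrt (1 - t\<^sup>2))" for z :: 'b
    proof -
      have "(t, z) \<in> cball 0 1 \<longleftrightarrow> t\<^sup>2 + (norm z)\<^sup>2 \<le> 1"
        by (simp add: norm_Pair)
      also have "\<dots> \<longleftrightarrow> t\<^sup>2 \<le> 1 \<and> (norm z)\<^sup>2 \<le> 1 - t\<^sup>2"
        by (smt (verit) zero_le_power2)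
      also have "\<dots> \<longleftrightarrow> t \<in> {-1..1} \<and> z \<in> cball 0 (sqrt (1 - t\<^sup>2))"
        using sqrt_ge_absD[of "norm z"]
        by (auto simp: abs_square_le_1 abs_le_iff real_le_rsqrt)
      finally show ?thesis .
    qed
    have "(\<integral>\<^sup>+z. ennreal \<bar>t\<bar> * indicator (cball 0 1) (t, z::'b) \<partial>lborel)
      = (\<integral>\<^sup>+z. (ennreal \<bar>t\<bar> * indicator {-1..1} t) * indicator (cball 0 (sqrt (1 - t\<^sup>2))) (z::'b) \<partial>lborel)"
      by (intro nn_integral_cong) (simp only: indicator_def iff, auto)
    also have "\<dots> = ennreal \<bar>t\<bar> * indicator {-1..1} t * emeasure lborel (cball (0::'b) (sqrt (1 - t\<^sup>2)))"
      by (rule nn_integral_cmult_indicator) auto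
    also have "\<dots> = ennreal (\<bar>t\<bar> * (?\<omega> * sqrt (1 - t\<^sup>2) ^ ?k)) * indicator {-1..1} t"
      by (auto simp: indicator_def emeasure_cball abs_square_le_1 ennreal_mult' abs_le_iff)
    finally show "(\<integral>\<^sup>+z. ennreal \<bar>t\<bar> * indicator (cball 0 1) (t, z::'b) \<partial>lborel) = \<dots>" .
  qed
  \<comment> \<open>The point 0 lies in both intervals, but the integrand vanishes there.\<close>
  also have "\<dots> = (\<integral>\<^sup>+t. ennreal (t * (?\<omega> * sqrt (1 - t\<^sup>2) ^ ?k)) * indicator {0..1} t \<partial>lborel)
     + (\<integral>\<^sup>+t. ennreal (-t * (?\<omega> * sqrt (1 - t\<^sup>2) ^ ?k)) * indicator {-1..0} t \<partial>lborel)"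
    by (subst nn_integral_add[symmetric]) (auto intro!: nn_integral_cong simp: indicator_def)
  also have "\<dots> = ennreal (?\<omega> / (real ?k + 2)) + ennreal (?\<omega> / (real ?k + 2))"
  proof (intro arg_cong2[where f="(+)"])
    \<comment> \<open>The chain rule breaks down at the end points, where the root is not
      differentiable; hence the form of the fundamental theorem that asks for derivatives in the
      interior only.\<close>
    have deriv: "((\<lambda>t. ?\<omega> / (real ?k + 2) * sqrt (1 - t\<^sup>2) ^ (?k + 2)) has_real_derivative
        - t * (?\<omega> * sqrt (1 - t\<^sup>2) ^ ?k)) (at t)" if "-1 < t" "t < 1" for t
    proof -
      have "t\<^sup>2 < 1" using that by (simp add: abs_square_less_1 abs_less_iff)
      then have s: "0 < sqrt (1 - t\<^sup>2)" by simp
      have "((\<lambda>t. sqrt (1 - t\<^sup>2)) has_real_derivative - t / sqrt (1 - t\<^sup>2)) (at t)"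
        using s by (auto intro!: derivative_eq_intros simp: field_simps)
      from DERIV_cmult[OF DERIV_power[OF this, of "Suc (Suc ?k)"], of "?\<omega> / (real ?k + 2)"]
      moreover have "?\<omega> / (real ?k + 2) * (of_nat (Suc (Suc ?k)) * (- t / sqrt (1 - t\<^sup>2) * sqrt (1 - t\<^sup>2) ^ (Suc (Suc ?k) - Suc 0)))
          = - t * (?\<omega> * sqrt (1 - t\<^sup>2) ^ ?k)"
      proof -
        have "real (Suc (Suc ?k)) = real ?k + 2" by simp
        moreover have "- t / sqrt (1 - t\<^sup>2) * sqrt (1 - t\<^sup>2) ^ (Suc (Suc ?k) - Suc 0) = - t * sqrt (1 - t\<^sup>2) ^ ?k"
          using s by simp
        ultimately show ?thesis by (simp only:) (simp add: field_simps)
      qed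
      ultimately show ?thesis by simp
    qed
    have "((\<lambda>t. t * (?\<omega> * sqrt (1 - t\<^sup>2) ^ ?k)) has_integral
        - (?\<omega> / (real ?k + 2) * sqrt (1 - 1\<^sup>2) ^ (?k + 2)) - - (?\<omega> / (real ?k + 2) * sqrt (1 - 0\<^sup>2) ^ (?k + 2))) {0..1}"
    proof (rule fundamental_theorem_of_calculus_interior)
      fix t :: real assume "t \<in> {0<..<1}"
      then show "((\<lambda>t. - (?\<omega> / (real ?k + 2) * sqrt (1 - t\<^sup>2) ^ (?k + 2))) has_vector_derivative
          t * (?\<omega> * sqrt (1 - t\<^sup>2) ^ ?k)) (at t)"
        using DERIV_minus[OF deriv[of t]] by (simp add: has_real_derivative_iff_has_vector_derivative)
    qed (auto intro!: continuous_intros)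
    then show "(\<integral>\<^sup>+t. ennreal (t * (?\<omega> * sqrt (1 - t\<^sup>2) ^ ?k)) * indicator {0..1} t \<partial>lborel) = ennreal (?\<omega> / (real ?k + 2))"
      by (intro set_nn_integral_has_integral) (auto simp: abs_square_le_1 intro!: mult_nonneg_nonneg)
    have "((\<lambda>t. - t * (?\<omega> * sqrt (1 - t\<^sup>2) ^ ?k)) has_integral
        (?\<omega> / (real ?k + 2) * sqrt (1 - 0\<^sup>2) ^ (?k + 2)) - (?\<omega> / (real ?k + 2) * sqrt (1 - (-1)\<^sup>2) ^ (?k + 2))) {-1..0}"
    proof (rule fundamental_theorem_of_calculus_interior)
      fix t :: real assume "t \<in> {-1<..<0}"
      then show "((\<lambda>t. ?\<omega> / (real ?k + 2) * sqrt (1 - t\<^sup>2) ^ (?k + 2)) has_vector_derivative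
          - t * (?\<omega> * sqrt (1 - t\<^sup>2) ^ ?k)) (at t)"
        using deriv[of t] by (simp add: has_real_derivative_iff_has_vector_derivative)
    qed (auto intro!: continuous_intros)
    then show "(\<integral>\<^sup>+t. ennreal (- t * (?\<omega> * sqrt (1 - t\<^sup>2) ^ ?k)) * indicator {-1..0} t \<partial>lborel) = ennreal (?\<omega> / (real ?k + 2))"
      by (intro set_nn_integral_has_integral) (auto simp: abs_square_le_1 mult_nonpos_nonneg)
  qed
  also have "\<dots> = ennreal (2 / (real DIM('a) + 1) * ?\<omega>)"
  proof -
    have "real DIM('a) + 1 = real ?k + 2" using dim by linarith
    moreover have "?\<omega> / (real ?k + 2) + ?\<omega> / (real ?k + 2) = 2 / (real ?k + 2) * ?\<omega>" by simp
    ultimately show ?thesis by (simp only:) (subst ennreal_plus[symmetric], simp_all)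
  qed
  finally have main: "(\<integral>\<^sup>+x\<in>cball 0 1. ennreal \<bar>x \<bullet> \<theta>\<bar> \<partial>lborel) = ennreal (2 / (real DIM('a) + 1) * ?\<omega>)" .
  have [measurable]: "cball (0::'a) 1 \<in> sets borel" by simp
  have "(\<integral>\<^sup>+x\<in>cball 0 1. ennreal \<bar>x \<bullet> u\<bar> \<partial>lborel) = (\<integral>\<^sup>+x. ennreal (norm u) * (ennreal \<bar>x \<bullet> \<theta>\<bar> * indicator (cball 0 1) x) \<partial>lborel)"
    by (subst th(2)) (auto intro!: nn_integral_cong simp: abs_mult ennreal_mult' indicator_def)
  also have "\<dots> = ennreal (norm u) * ennreal (2 / (real DIM('a) + 1) * ?\<omega>)"
    by (subst nn_integral_cmult) (simp_all add: main)
  finally show ?thesis by (simp add: ennreal_mult'[symmetric] mult_ac)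
qed auto

section \<open>Hausdorff measure\<close>

text \<open>Covers obtained from Vitali's theorem or by joining two covers are not indexed by
  natural numbers; this transports them.\<close>

lemma hausdorff_pre_le_cover:
  fixes x :: "'i \<Rightarrow> 'a::euclidean_space"
  assumes "countable I" "\<And>i. i \<in> I \<Longrightarrow> 0 < r i \<and> r i \<le> \<delta>" "E \<subseteq> (\<Union>i\<in>I. cball (x i) (r i))"
  shows "hausdorff_pre k \<delta> E \<le> ennreal (unit_ball_vol (real k)) * (\<Sum>\<^sub>\<infinity>i\<in>I. ennreal (r i ^ k))"
proof -
  define J where "J = to_nat_on I ` I"
  let ?g = "from_nat_into I"
  have inv: "?g (to_nat_on I i) = i" if "i \<in> I" for i using that assms(1) by simp
  have inj: "inj_on (to_nat_on I) I" using assms(1) by (rule inj_on_to_nat_on)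
  have "(\<Sum>\<^sub>\<infinity>j\<in>J. ennreal (r (?g j) ^ k)) = (\<Sum>\<^sub>\<infinity>i\<in>I. ennreal (r i ^ k))"
    unfolding J_def by (subst infsum_reindex[OF inj]) (auto intro!: infsum_cong simp: inv)
  moreover have "(J, x \<circ> ?g, r \<circ> ?g) \<in> {(J, x, r). (\<forall>j\<in>J. 0 < r j \<and> r j \<le> \<delta>) \<and> E \<subseteq> (\<Union>j\<in>J. cball (x j) (r j))}"
    using assms(2,3) by (auto simp: J_def inv)
  ultimately show ?thesis
    unfolding hausdorff_pre_def by (intro INF_lower2[where i="(J, x \<circ> ?g, r \<circ> ?g)"]) auto
qed

lemma hausdorff_pre_approx:
  fixes E :: "'a::euclidean_space set"
  assumes "hausdorff_pre k \<delta> E < c"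
  shows "\<exists>J (x :: nat \<Rightarrow> 'a) r. (\<forall>j\<in>J. 0 < r j \<and> r j \<le> \<delta>) \<and> E \<subseteq> (\<Union>j\<in>J. cball (x j) (r j)) \<and>
    ennreal (unit_ball_vol (real k)) * (\<Sum>\<^sub>\<infinity>j\<in>J. ennreal (r j ^ k)) < c"
proof -
  obtain p where p: "p \<in> {(J :: nat set, x :: nat \<Rightarrow> 'a, r :: nat \<Rightarrow> real).
      (\<forall>j\<in>J. 0 < r j \<and> r j \<le> \<delta>) \<and> E \<subseteq> (\<Union>j\<in>J. cball (x j) (r j))}"
    "(case p of (J, x, r) \<Rightarrow> ennreal (unit_ball_vol (real k)) * (\<Sum>\<^sub>\<infinity>j\<in>J. ennreal (r j ^ k))) < c"
    using assms unfolding hausdorff_pre_def INF_less_iff by blast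
  obtain J x r where "p = (J, x, r)" by (rule prod_cases3)
  with p show ?thesis by (intro exI[of _ J] exI[of _ x] exI[of _ r]) simp
qed

lemma hausdorff_pre_mono: "E \<subseteq> F \<Longrightarrow> hausdorff_pre k \<delta> E \<le> hausdorff_pre k \<delta> F"
  unfolding hausdorff_pre_def by (rule INF_superset_mono) auto

lemma hausdorff_meas_mono: "E \<subseteq> F \<Longrightarrow> hausdorff_meas k E \<le> hausdorff_meas k F"
  unfolding hausdorff_meas_eq_SUP by (rule SUP_mono) (auto intro: hausdorff_pre_mono)

lemma hausdorff_pre_le_meas: "\<delta> > 0 \<Longrightarrow> hausdorff_pre k \<delta> E \<le> hausdorff_meas k E"
  unfolding hausdorff_meas_eq_SUP by (rule SUP_upper) auto

lemma hausdorff_meas_leI: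
  "(\<And>\<delta>. \<delta> > 0 \<Longrightarrow> hausdorff_pre k \<delta> E \<le> c) \<Longrightarrow> hausdorff_meas k E \<le> c"
  unfolding hausdorff_meas_eq_SUP by (rule SUP_least) auto

lemma hausdorff_pre_empty [simp]: "hausdorff_pre k \<delta> {} = 0"
  using hausdorff_pre_le_cover[of "{}" _ \<delta> "{}" _ k] by simp

lemma hausdorff_meas_empty [simp]: "hausdorff_meas k {} = 0"
  by (simp add: hausdorff_meas_eq_SUP)

lemma hausdorff_pre_Un:
  fixes E F :: "'a::euclidean_space set"
  shows "hausdorff_pre k \<delta> (E \<union> F) \<le> hausdorff_pre k \<delta> E + hausdorff_pre k \<delta> F"
proof -
  have *: "hausdorff_pre k \<delta> (E \<union> F) \<le> a + b" if ab: "hausdorff_pre k \<delta> E < a" "hausdorff_pre k \<delta> F < b" for a b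
  proof -
    let ?\<omega> = "ennreal (unit_ball_vol (real k))"
    obtain J and x :: "nat \<Rightarrow> 'a" and r where 1: "\<forall>j\<in>J. 0 < r j \<and> r j \<le> \<delta>" "E \<subseteq> (\<Union>j\<in>J. cball (x j) (r j))"
      "?\<omega> * (\<Sum>\<^sub>\<infinity>j\<in>J. ennreal (r j ^ k)) < a"
        using hausdorff_pre_approx[OF ab(1)] by (elim exE conjE)
    obtain K and y :: "nat \<Rightarrow> 'a" and s where 2: "\<forall>j\<in>K. 0 < s j \<and> s j \<le> \<delta>" "F \<subseteq> (\<Union>j\<in>K. cball (y j) (s j))"
      "?\<omega> * (\<Sum>\<^sub>\<infinity>j\<in>K. ennreal (s j ^ k)) < b"
        using hausdorff_pre_approx[OF ab(2)] by (elim exE conjE)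
    have "hausdorff_pre k \<delta> (E \<union> F) \<le> ?\<omega> * (\<Sum>\<^sub>\<infinity>i\<in>Inl ` J \<union> Inr ` K. ennreal (case_sum r s i ^ k))"
      using 1(1,2) 2(1,2) by (intro hausdorff_pre_le_cover[where x="case_sum x y"]) auto
    also have "(\<Sum>\<^sub>\<infinity>i\<in>Inl ` J \<union> Inr ` K. ennreal (case_sum r s i ^ k))
        = (\<Sum>\<^sub>\<infinity>i\<in>Inl ` J. ennreal (case_sum r s i ^ k)) + (\<Sum>\<^sub>\<infinity>i\<in>Inr ` K. ennreal (case_sum r s i ^ k))"
      by (intro infsum_Un_disjoint nonneg_summable_on_complete) auto
    also have "\<dots> = (\<Sum>\<^sub>\<infinity>j\<in>J. ennreal (r j ^ k)) + (\<Sum>\<^sub>\<infinity>j\<in>K. ennreal (s j ^ k))"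
      by (simp add: infsum_reindex o_def)
    also have "?\<omega> * \<dots> \<le> a + b"
      unfolding distrib_left using 1(3) 2(3) by (intro add_mono less_imp_le)
    finally show ?thesis .
  qed
  show ?thesis
  proof (cases "hausdorff_pre k \<delta> E = \<infinity> \<or> hausdorff_pre k \<delta> F = \<infinity>")
    case False
    then obtain a b where ab: "hausdorff_pre k \<delta> E = ennreal a" "hausdorff_pre k \<delta> F = ennreal b" "0 \<le> a" "0 \<le> b"
      by (metis ennreal_cases infinity_ennreal_def)
    show ?thesis
    proof (rule ennreal_le_epsilon)
      fix e :: real assume "0 < e"
      then have "hausdorff_pre k \<delta> (E \<union> F) \<le> ennreal (a + e/2) + ennreal (b + e/2)"
        using ab by (intro *) (auto intro!: ennreal_lessI)
      then show "hausdorff_pre k \<delta> (E \<union> F) \<le> hausdorff_pre k \<delta> E + hausdorff_pre k \<delta> F + ennreal e"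
        using ab \<open>0 < e\<close> by (simp add: ennreal_plus[symmetric] add_ac del: ennreal_plus)
    qed
  qed auto
qed

lemma hausdorff_meas_Un:
  "hausdorff_meas k (E \<union> F) \<le> hausdorff_meas k E + hausdorff_meas k F"
proof (rule hausdorff_meas_leI)
  fix \<delta> :: real assume "0 < \<delta>"
  then show "hausdorff_pre k \<delta> (E \<union> F) \<le> hausdorff_meas k E + hausdorff_meas k F"
    by (intro order_trans[OF hausdorff_pre_Un] add_mono hausdorff_pre_le_meas)
qed

lemma hausdorff_meas_UN_le_card:
  assumes "finite I" "\<And>i. i \<in> I \<Longrightarrow> hausdorff_meas k (A i) \<le> c"
  shows "hausdorff_meas k (\<Union>i\<in>I. A i) \<le> of_nat (card I) * c"
  using assms
proof (induction I rule: finite_induct)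
  case (insert i I)
  have "hausdorff_meas k (\<Union>i\<in>insert i I. A i) \<le> hausdorff_meas k (A i) + hausdorff_meas k (\<Union>i\<in>I. A i)"
    using hausdorff_meas_Un by simp
  also have "\<dots> \<le> c + of_nat (card I) * c"
    using insert by (intro add_mono) auto
  finally show ?case using insert by (simp add: distrib_right)
qed simp

lemma infsum_cmult_ennreal:
  fixes f :: "'i \<Rightarrow> ennreal"
  shows "(\<Sum>\<^sub>\<infinity>i\<in>I. c * f i) = c * (\<Sum>\<^sub>\<infinity>i\<in>I. f i)"
  by (simp add: nonneg_infsum_complete sum_distrib_left[symmetric] SUP_mult_left_ennreal)

lemma infsum_ennreal_leI:
  fixes f :: "'i \<Rightarrow> ennreal"
  assumes "\<And>F. finite F \<Longrightarrow> F \<subseteq> I \<Longrightarrow> sum f F \<le> c"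
  shows "infsum f I \<le> c"
  by (rule infsum_le_finite_sums) (auto intro: assms nonneg_summable_on_complete)

lemma suminf_indicator_le_infsum:
  fixes f :: "nat \<Rightarrow> ennreal"
  shows "(\<Sum>j. if j \<in> J then f j else 0) \<le> (\<Sum>\<^sub>\<infinity>j\<in>J. f j)"
proof (rule suminf_le_const[OF summableI])
  fix n
  have "(\<Sum>j<n. if j \<in> J then f j else 0) = sum f ({..<n} \<inter> J)"
    by (simp add: sum.inter_restrict)
  also have "\<dots> \<le> infsum f J"
    unfolding nonneg_infsum_complete[of J f, OF zero_le] by (intro SUP_upper) auto
  finally show "(\<Sum>j<n. if j \<in> J then f j else 0) \<le> (\<Sum>\<^sub>\<infinity>j\<in>J. f j)" .
qed

text \<open>Mass distribution principle. The covers of the Hausdorff measure consist of balls, so a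
  sharp bound on balls keeps the sharp constant, with no isodiametric inequality. Subadditivity is
  asked for closed covers only, which keeps the preimages in the application measurable.\<close>

lemma hausdorff_meas_mass_distribution:
  fixes \<mu> :: "'a::euclidean_space set \<Rightarrow> ennreal"
  assumes subadd: "\<And>B :: nat \<Rightarrow> 'a set. (\<And>j. closed (B j)) \<Longrightarrow> E \<subseteq> (\<Union>j. B j) \<Longrightarrow> \<mu> E \<le> (\<Sum>j. \<mu> (B j))"
    and empty: "\<mu> {} = 0" and "0 < \<delta>"
    and le: "\<And>x r. 0 < r \<Longrightarrow> r \<le> \<delta> \<Longrightarrow> \<mu> (cball x r) \<le> ennreal (unit_ball_vol (real k) * r ^ k)"
  shows "\<mu> E \<le> hausdorff_meas k E"
proof -
  let ?\<omega> = "ennreal (unit_ball_vol (real k))"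
  have "\<mu> E \<le> hausdorff_pre k \<delta> E"
    unfolding hausdorff_pre_def
  proof (intro INF_greatest, clarify)
    fix J and x :: "nat \<Rightarrow> 'a" and r
    assume r: "\<forall>j\<in>J. 0 < r j \<and> r j \<le> \<delta>" and E: "E \<subseteq> (\<Union>j\<in>J. cball (x j) (r j))"
    \<comment> \<open>Indices outside \<open>J\<close> get the empty set, so the cover becomes a
      sequence without additional mass.\<close>
    define B where "B j = (if j \<in> J then cball (x j) (r j) else {})" for j
    have "\<mu> E \<le> (\<Sum>j. \<mu> (B j))"
      by (rule subadd) (use E in \<open>auto simp: B_def\<close>)
    also have "\<dots> \<le> (\<Sum>j. ?\<omega> * (if j \<in> J then ennreal (r j ^ k) else 0))"
      using r by (intro suminf_le summableI) (auto simp: B_def empty ennreal_mult'[symmetric] intro!: le)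
    also have "\<dots> = ?\<omega> * (\<Sum>j. if j \<in> J then ennreal (r j ^ k) else 0)"
      by (rule ennreal_suminf_cmult)
    also have "\<dots> \<le> ?\<omega> * (\<Sum>\<^sub>\<infinity>j\<in>J. ennreal (r j ^ k))"
      by (intro mult_left_mono suminf_indicator_le_infsum) auto
    finally show "\<mu> E \<le> ?\<omega> * (\<Sum>\<^sub>\<infinity>j\<in>J. ennreal (r j ^ k))" .
  qed
  also have "\<dots> \<le> hausdorff_meas k E" using \<open>0 < \<delta>\<close> by (rule hausdorff_pre_le_meas)
  finally show ?thesis .
qed

section \<open>Sharp upper bounds by Vitali coverings\<close>

lemma infsum_disjoint_balls_le:
  fixes a :: "'i \<Rightarrow> 'b::euclidean_space"
  assumes C: "pairwise (\<lambda>i j. disjnt (ball (a i) (r i)) (ball (a j) (r j))) C"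
    and r: "\<And>i. i \<in> C \<Longrightarrow> 0 < r i" and U: "\<And>i. i \<in> C \<Longrightarrow> ball (a i) (r i) \<subseteq> U" "U \<in> sets lborel"
  shows "ennreal (unit_ball_vol (real DIM('b))) * (\<Sum>\<^sub>\<infinity>i\<in>C. ennreal (r i ^ DIM('b))) \<le> emeasure lborel U"
proof -
  let ?\<omega> = "ennreal (unit_ball_vol (real DIM('b)))"
  have "(\<Sum>\<^sub>\<infinity>i\<in>C. ?\<omega> * ennreal (r i ^ DIM('b))) \<le> emeasure lborel U"
  proof (rule infsum_ennreal_leI)
    fix F assume F: "finite F" "F \<subseteq> C"
    have "(\<Sum>i\<in>F. ?\<omega> * ennreal (r i ^ DIM('b))) = (\<Sum>i\<in>F. emeasure lborel (ball (a i) (r i)))"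
      using r F by (intro sum.cong) (auto simp: emeasure_ball ennreal_mult' less_imp_le subset_iff)
    also have "\<dots> = emeasure lborel (\<Union>i\<in>F. ball (a i) (r i))"
      using C F by (intro sum_emeasure) (auto simp: disjoint_family_on_def pairwise_def disjnt_def)
    also have "\<dots> \<le> emeasure lborel U" using F U by (intro emeasure_mono) auto
    finally show "(\<Sum>i\<in>F. ?\<omega> * ennreal (r i ^ DIM('b))) \<le> emeasure lborel U" .
  qed
  then show ?thesis
    by (simp add: infsum_cmult_ennreal)
qed

text \<open>Vitali's theorem exhausts a ball only up to a null set, whose contribution is removed
  here: it lies in an open set of small volume, and the fivefold enlargements of disjoint balls
  inside that set cover it.\<close>

lemma hausdorff_pre_null:
  fixes N :: "'b::euclidean_space set"
  assumes "negligible N" "0 < \<delta>"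
  shows "hausdorff_pre DIM('b) \<delta> N = 0"
proof -
  let ?k = "DIM('b)"
  have "hausdorff_pre ?k \<delta> N \<le> 0 + ennreal e" if "0 < e" for e :: real
  proof -
    \<comment> \<open>The fivefold radii multiply the sum by 5^k; for the same reason the radii in
      \<open>K\<close> stop at \<delta> / 5.\<close>
    have "0 < e / 5 ^ ?k" using that by simp
    then obtain U where U: "open U" "N \<subseteq> U" "emeasure lborel U < ennreal (e / 5 ^ ?k)"
    proof -
      have "N \<in> null_sets lebesgue" using assms(1) by (simp add: negligible_iff_null_sets)
      then obtain N' where N': "N' \<in> null_sets lborel" "N \<subseteq> N'"
        by (auto simp: null_sets_completion_iff2)
      then obtain U where "open U" "N' \<subseteq> U" "emeasure lborel (U - N') < ennreal (e / 5 ^ ?k)"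
        using outer_regular_lborel[of N' "e / 5 ^ ?k"] \<open>0 < e / 5 ^ ?k\<close> by (auto simp: null_sets_def)
      then show ?thesis using that N' emeasure_Diff_null_set[of N' lborel U] by (auto simp: null_sets_def)
    qed
    define K where "K = {(c, \<rho>). 0 < \<rho> \<and> \<rho> \<le> \<delta> / 5 \<and> ball c \<rho> \<subseteq> U}"
    have K: "0 < snd i \<and> snd i \<le> \<delta> / 5 \<and> ball (fst i) (snd i) \<subseteq> U" if "i \<in> K" for i
      using that by (simp add: K_def case_prod_beta)
    have NK: "N \<subseteq> (\<Union>i\<in>K. ball (fst i) (snd i))"
    proof
      fix x assume "x \<in> N"
      then obtain \<rho> where "0 < \<rho>" "ball x \<rho> \<subseteq> U" using U openE by blast
      then have "(x, min \<rho> (\<delta> / 5)) \<in> K" using \<open>0 < \<delta>\<close> by (auto simp: K_def)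
      then show "x \<in> (\<Union>i\<in>K. ball (fst i) (snd i))" using \<open>0 < \<rho>\<close> \<open>0 < \<delta>\<close> by force
    qed
    obtain C where C: "countable C" "C \<subseteq> K" "pairwise (\<lambda>i j. disjnt (ball (fst i) (snd i)) (ball (fst j) (snd j))) C"
      "N \<subseteq> (\<Union>i\<in>C. ball (fst i) (5 * snd i))"
    proof (rule Vitali_covering_lemma_balls[OF NK])
      show "0 < snd i \<and> snd i \<le> \<delta> / 5" if "i \<in> K" for i using K that by blast
    qed
    have "hausdorff_pre ?k \<delta> N \<le> ennreal (unit_ball_vol (real ?k)) * (\<Sum>\<^sub>\<infinity>i\<in>C. ennreal ((5 * snd i) ^ ?k))"
    proof (rule hausdorff_pre_le_cover)
      show "N \<subseteq> (\<Union>i\<in>C. cball (fst i) (5 * snd i))" using C(4) ball_subset_cball by blast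
    qed (use C in \<open>auto simp: K_def\<close>)
    also have "(\<Sum>\<^sub>\<infinity>i\<in>C. ennreal ((5 * snd i) ^ ?k)) = ennreal (5 ^ ?k) * (\<Sum>\<^sub>\<infinity>i\<in>C. ennreal (snd i ^ ?k))"
      by (subst infsum_cmult_ennreal[symmetric]) (simp_all add: power_mult_distrib ennreal_mult')
    also have "ennreal (unit_ball_vol (real ?k)) * \<dots> = ennreal (5 ^ ?k) * (ennreal (unit_ball_vol (real ?k)) * (\<Sum>\<^sub>\<infinity>i\<in>C. ennreal (snd i ^ ?k)))"
      by (simp add: mult_ac)
    also have "\<dots> \<le> ennreal (5 ^ ?k) * emeasure lborel U"
    proof (intro mult_left_mono infsum_disjoint_balls_le)
      show "ball (fst i) (snd i) \<subseteq> U" if "i \<in> C" for i using C(2) that by (blast dest: K)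
      show "0 < snd i" if "i \<in> C" for i using C(2) that by (blast dest: K)
    qed (use C U(1) in auto)
    also have "\<dots> \<le> ennreal (5 ^ ?k) * ennreal (e / 5 ^ ?k)"
      using U(3) by (intro mult_left_mono) auto
    also have "\<dots> = ennreal e" by (simp add: ennreal_mult'[symmetric])
    finally show ?thesis by simp
  qed
  then have "hausdorff_pre ?k \<delta> N \<le> 0" by (rule ennreal_le_epsilon)
  then show ?thesis by simp
qed

text \<open>For \<delta> < r the ball may not cover itself. Disjoint balls of radius at most
  \<delta> fill it up to a null set, and their volumes add up to at most that of the ball.\<close>

lemma hausdorff_pre_cball:
  fixes p :: "'b::euclidean_space"
  assumes "0 < \<delta>" "0 \<le> r"
  shows "hausdorff_pre DIM('b) \<delta> (cball p r) \<le> ennreal (unit_ball_vol (real DIM('b)) * r ^ DIM('b))"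
proof -
  let ?k = "DIM('b)" let ?\<omega> = "ennreal (unit_ball_vol (real DIM('b)))"
  define K where "K = {(c, \<rho>). 0 < \<rho> \<and> \<rho> \<le> \<delta> \<and> ball c \<rho> \<subseteq> ball p r}"
  have K: "0 < snd i \<and> snd i \<le> \<delta> \<and> ball (fst i) (snd i) \<subseteq> ball p r" if "i \<in> K" for i
    using that by (simp add: K_def case_prod_beta)
  obtain C where C: "countable C" "C \<subseteq> K"
    "pairwise (\<lambda>i j. disjnt (ball (fst i) (snd i)) (ball (fst j) (snd j))) C"
    "negligible (ball p r - (\<Union>i\<in>C. ball (fst i) (snd i)))"
  proof (rule Vitali_covering_theorem_balls[of "ball p r" K fst snd])
    fix x d assume "x \<in> ball p r" "0 < (d::real)"
    then obtain \<rho> where "0 < \<rho>" "ball x \<rho> \<subseteq> ball p r" using open_ball openE by blast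
    then have "(x, min \<rho> (min \<delta> (d / 2))) \<in> K" using \<open>0 < \<delta>\<close> \<open>0 < d\<close> by (auto simp: K_def)
    then show "\<exists>i. i \<in> K \<and> x \<in> ball (fst i) (snd i) \<and> snd i < d"
      using \<open>0 < \<rho>\<close> \<open>0 < \<delta>\<close> \<open>0 < d\<close> by (intro exI[of _ "(x, min \<rho> (min \<delta> (d / 2)))"]) auto
  qed
  \<comment> \<open>The small balls fill the open ball; the bounding sphere joins the null
    set.\<close>
  let ?G = "\<Union>i\<in>C. cball (fst i) (snd i)"
  have "negligible (ball p r - (\<Union>i\<in>C. ball (fst i) (snd i)) \<union> sphere p r)"
    using C(4) negligible_sphere by (rule negligible_Un)
  moreover have "cball p r \<subseteq> ?G \<union> (ball p r - (\<Union>i\<in>C. ball (fst i) (snd i)) \<union> sphere p r)"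
    by force
  ultimately have "hausdorff_pre ?k \<delta> (cball p r) \<le> hausdorff_pre ?k \<delta> ?G + 0"
    using order_trans[OF hausdorff_pre_mono hausdorff_pre_Un] hausdorff_pre_null[OF _ \<open>0 < \<delta>\<close>] by metis
  also have "\<dots> \<le> ?\<omega> * (\<Sum>\<^sub>\<infinity>i\<in>C. ennreal (snd i ^ ?k))"
    using C by (simp, intro hausdorff_pre_le_cover) (auto simp: K_def)
  also have "\<dots> \<le> emeasure lborel (ball p r)"
  proof (intro infsum_disjoint_balls_le)
    show "ball (fst i) (snd i) \<subseteq> ball p r" if "i \<in> C" for i using C(2) that by (blast dest: K)
    show "0 < snd i" if "i \<in> C" for i using C(2) that by (blast dest: K)
  qed (use C in auto)
  also have "\<dots> = ennreal (unit_ball_vol (real ?k) * r ^ ?k)"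
    using assms by (simp add: emeasure_ball)
  finally show ?thesis .
qed

text \<open>The image of a cover by balls is covered by balls of the same radii about the images of
  the centres, so the estimate in R^k passes to k-dimensional balls in the larger space.\<close>

lemma hausdorff_meas_nonexpansive_image_cball:
  fixes g :: "'b::euclidean_space \<Rightarrow> 'a::euclidean_space"
  assumes g: "\<And>x y. dist (g x) (g y) \<le> dist x y" and "0 \<le> r"
  shows "hausdorff_meas DIM('b) (g ` cball p r) \<le> ennreal (unit_ball_vol (real DIM('b)) * r ^ DIM('b))"
proof (rule hausdorff_meas_leI)
  fix \<delta> :: real assume "0 < \<delta>"
  have "hausdorff_pre DIM('b) \<delta> (g ` cball p r) \<le> hausdorff_pre DIM('b) \<delta> (cball p r)"
    unfolding hausdorff_pre_def[of _ _ "cball p r"]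
  proof (intro INF_greatest, clarify)
    fix J and x :: "nat \<Rightarrow> 'b" and s
    assume s: "\<forall>j\<in>J. 0 < s j \<and> s j \<le> \<delta>" and E: "cball p r \<subseteq> (\<Union>j\<in>J. cball (x j) (s j))"
    have "g ` cball p r \<subseteq> (\<Union>j\<in>J. cball (g (x j)) (s j))"
    proof (rule image_subsetI)
      fix y assume "y \<in> cball p r"
      then obtain j where "j \<in> J" "dist (x j) y \<le> s j" using E by auto
      then have "dist (g (x j)) (g y) \<le> s j" using g order_trans by blast
      then show "g y \<in> (\<Union>j\<in>J. cball (g (x j)) (s j))" using \<open>j \<in> J\<close> by auto
    qed
    then show "hausdorff_pre DIM('b) \<delta> (g ` cball p r) \<le> ennreal (unit_ball_vol (real DIM('b))) * (\<Sum>\<^sub>\<infinity>j\<in>J. ennreal (s j ^ DIM('b)))"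
      using s by (intro hausdorff_pre_le_cover) auto
  qed
  also have "\<dots> \<le> ennreal (unit_ball_vol (real DIM('b)) * r ^ DIM('b))"
    using \<open>0 < \<delta>\<close> \<open>0 \<le> r\<close> by (rule hausdorff_pre_cball)
  finally show "hausdorff_pre DIM('b) \<delta> (g ` cball p r) \<le> ennreal (unit_ball_vol (real DIM('b)) * r ^ DIM('b))" .
qed

section \<open>Fourier transform of trigonometric polynomials\<close>

lemma gaussian_integrable_real:
  assumes "0 < c"
  shows "integrable lborel (\<lambda>t::real. exp (- (t / c)\<^sup>2 / 2))"
proof -
  have "integrable lborel (\<lambda>x. sqrt (2 * pi) * std_normal_density x)"
    using integrable_std_normal_moment[of 0] by simp
  then have "integrable lborel (\<lambda>x::real. exp (- x\<^sup>2 / 2))"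
    by (simp add: std_normal_density_def)
  from lborel_integrable_real_affine[OF this, of "1 / c" 0] show ?thesis
    using assms by simp
qed

text \<open>The characteristic function of the standard normal distribution, rescaled to width
  \<open>c\<close>.\<close>

lemma gaussian_fourier_real:
  assumes "0 < c"
  shows "(\<integral>t. complex_of_real (exp (- (t / c)\<^sup>2 / 2)) * iexp (t * w) \<partial>lborel)
    = complex_of_real (sqrt (2 * pi) * c * exp (- (c * w)\<^sup>2 / 2))"
proof -
  have "(\<integral>x. std_normal_density x *\<^sub>R iexp (u * x) \<partial>lborel) = complex_of_real (exp (- u\<^sup>2 / 2))" for u
    using fun_cong[OF char_std_normal_distribution, of u] unfolding char_def
    by (subst (asm) integral_density) (auto simp: normal_density_nonneg)
  then have std: "(\<integral>x. complex_of_real (std_normal_density x) * iexp (u * x) \<partial>lborel) = complex_of_real (exp (- u\<^sup>2 / 2))" for u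
    by (simp add: scaleR_conv_of_real)
  have "(\<integral>t. complex_of_real (exp (- (t / c)\<^sup>2 / 2)) * iexp (t * w) \<partial>lborel)
      = c *\<^sub>R (\<integral>x. complex_of_real (exp (- ((0 + c * x) / c)\<^sup>2 / 2)) * iexp ((0 + c * x) * w) \<partial>lborel)"
    using assms by (subst lborel_integral_real_affine[where c=c and t=0]) auto
  also have "\<dots> = c *\<^sub>R (\<integral>x. complex_of_real (sqrt (2 * pi)) * (complex_of_real (std_normal_density x) * iexp ((c * w) * x)) \<partial>lborel)"
  proof (intro arg_cong2[where f=scaleR] Bochner_Integration.integral_cong refl)
    fix x :: real
    have "exp (- ((0 + c * x) / c)\<^sup>2 / 2) = sqrt (2 * pi) * std_normal_density x"
      using assms by (simp add: std_normal_density_def)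
    moreover have "(0 + c * x) * w = (c * w) * x" by simp
    ultimately show "complex_of_real (exp (- ((0 + c * x) / c)\<^sup>2 / 2)) * iexp ((0 + c * x) * w)
        = complex_of_real (sqrt (2 * pi)) * (complex_of_real (std_normal_density x) * iexp ((c * w) * x))"
      by (simp only: of_real_mult mult.assoc)
  qed
  also have "\<dots> = c *\<^sub>R (complex_of_real (sqrt (2 * pi)) * complex_of_real (exp (- (c * w)\<^sup>2 / 2)))"
    by (simp only: integral_mult_right_zero std)
  finally show ?thesis by (simp add: scaleR_conv_of_real mult_ac)
qed

lemma prod_exp_half:
  fixes g :: "'i \<Rightarrow> complex"
  assumes "finite X"
  shows "(\<Prod>v\<in>X. exp (g v) / 2) = (1/2) ^ card X * exp (\<Sum>v\<in>X. g v)"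
  using assms by (induction rule: finite_induct) (simp_all add: exp_add)

text \<open>Gaussian and character both factor over the coordinates. The form of \<open>x\<close> is
  that in which \<open>lborel\<close> is the image of a product measure.\<close>

lemma exp_sum_Basis:
  fixes f :: "'a::euclidean_space \<Rightarrow> real"
  defines "x \<equiv> (\<Sum>b\<in>Basis. f b *\<^sub>R b)"
  shows "exp (- (norm x / c)\<^sup>2 / 2) = (\<Prod>b\<in>Basis. exp (- (f b / c)\<^sup>2 / 2))"
    and "iexp (x \<bullet> w) = (\<Prod>b\<in>Basis. iexp (f b * (w \<bullet> b)))"
proof -
  have "(norm x)\<^sup>2 = (\<Sum>b\<in>Basis. (f b)\<^sup>2)"
    unfolding power2_norm_eq_inner euclidean_inner[of x x] by (simp add: x_def power2_eq_square)
  then have "- (norm x / c)\<^sup>2 / 2 = (\<Sum>b\<in>Basis. - (f b / c)\<^sup>2 / 2)"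
    by (simp add: power_divide sum_divide_distrib[symmetric] sum_negf)
  then show "exp (- (norm x / c)\<^sup>2 / 2) = (\<Prod>b\<in>Basis. exp (- (f b / c)\<^sup>2 / 2))"
    by (simp add: exp_sum)
  have "\<i> * complex_of_real (x \<bullet> w) = (\<Sum>b\<in>Basis. \<i> * complex_of_real (f b * (w \<bullet> b)))"
    unfolding euclidean_inner[of x w] by (simp add: x_def sum_distrib_left)
  then show "iexp (x \<bullet> w) = (\<Prod>b\<in>Basis. iexp (f b * (w \<bullet> b)))"
    by (simp add: exp_sum)
qed

lemma gaussian_integrable:
  assumes "0 < c"
  shows "integrable lborel (\<lambda>x::'a::euclidean_space. exp (- (norm x / c)\<^sup>2 / 2))"
proof -
  interpret product_sigma_finite "\<lambda>_::'a. lborel :: real measure" by standard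
  have "integrable (Pi\<^sub>M Basis (\<lambda>_. lborel)) (\<lambda>f. \<Prod>b\<in>(Basis :: 'a set). exp (- (f b / c)\<^sup>2 / 2))"
    using gaussian_integrable_real[OF assms] by (intro product_integrable_prod) auto
  then show ?thesis
    unfolding exp_sum_Basis(1)[symmetric] by (subst lborel_eq, subst integrable_distr_eq) simp_all
qed

lemma gaussian_fourier:
  fixes w :: "'a::euclidean_space"
  assumes "0 < c"
  shows "(\<integral>x. complex_of_real (exp (- (norm x / c)\<^sup>2 / 2)) * iexp (x \<bullet> w) \<partial>lborel)
    = complex_of_real ((sqrt (2 * pi) * c) ^ DIM('a) * exp (- (c * norm w)\<^sup>2 / 2))"
proof -
  interpret product_sigma_finite "\<lambda>_::'a. lborel :: real measure" by standard
  have int: "integrable lborel (\<lambda>t. complex_of_real (exp (- (t / c)\<^sup>2 / 2)) * iexp (t * v))" for v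
    by (rule Bochner_Integration.integrable_bound[OF gaussian_integrable_real[OF assms]]) (auto simp: norm_mult)
  have "(\<integral>x. complex_of_real (exp (- (norm x / c)\<^sup>2 / 2)) * iexp (x \<bullet> w) \<partial>lborel)
    = (\<integral>f. (\<Prod>b\<in>(Basis :: 'a set). complex_of_real (exp (- (f b / c)\<^sup>2 / 2)) * iexp (f b * (w \<bullet> b))) \<partial>(Pi\<^sub>M Basis (\<lambda>_. lborel)))"
    by (subst lborel_eq, subst integral_distr) (simp_all only: exp_sum_Basis prod.distrib of_real_prod, measurable)
  also have "\<dots> = (\<Prod>b\<in>(Basis :: 'a set). complex_of_real (sqrt (2 * pi) * c * exp (- (c * (w \<bullet> b))\<^sup>2 / 2)))"
    using int by (subst product_integral_prod) (auto simp only: gaussian_fourier_real[OF assms] finite_Basis)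
  also have "\<dots> = complex_of_real ((sqrt (2 * pi) * c) ^ DIM('a) * (\<Prod>b\<in>(Basis :: 'a set). exp (- (c * (w \<bullet> b))\<^sup>2 / 2)))"
    by (simp add: prod.distrib flip: of_real_prod)
  also have "(\<Prod>b\<in>(Basis :: 'a set). exp (- (c * (w \<bullet> b))\<^sup>2 / 2)) = exp (- (c * norm w)\<^sup>2 / 2)"
    using exp_sum_Basis(1)[of "\<lambda>b. w \<bullet> b" "1 / c"] by (simp add: euclidean_representation mult.commute)
  finally show ?thesis .
qed

section \<open>Spectrum of trigonometric polynomials\<close>

lemma integrable_continuous_compact_support:
  fixes \<psi> :: "'a::euclidean_space \<Rightarrow> complex"
  assumes "continuous_on UNIV \<psi>" "compact (closure {x. \<psi> x \<noteq> 0})"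
  shows "integrable lborel \<psi>"
proof -
  have "integrable lborel (\<lambda>x. indicator (closure {x. \<psi> x \<noteq> 0}) x *\<^sub>R \<psi> x)"
    by (rule borel_integrable_compact[OF assms(2) continuous_on_subset[OF assms(1)]]) auto
  moreover have "indicator (closure {x. \<psi> x \<noteq> 0}) x *\<^sub>R \<psi> x = \<psi> x" for x
    using closure_subset[of "{x. \<psi> x \<noteq> 0}"] by (auto simp: indicator_def)
  ultimately show ?thesis by simp
qed

text \<open>The transform of a Gaussian of width c has height of order c^d and concentrates at scale
  1/c; at a fixed distance from the centre the exponential wins.\<close>

lemma power_times_gaussian_tendsto_0:
  assumes "0 < (a::real)"
  shows "(\<lambda>n. (b * real (Suc n)) ^ k * exp (- (real (Suc n) * a)\<^sup>2 / 2)) \<longlonglongrightarrow> 0"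
proof -
  have "((\<lambda>x. (b * x) ^ k * exp (- (x * a)\<^sup>2 / 2)) \<longlongrightarrow> 0) at_top"
  proof (rule tendsto_rabs_zero_cancel, rule tendsto_sandwich[OF always_eventually _ tendsto_const])
    let ?m = "a\<^sup>2 / 2"
    show "\<forall>\<^sub>F x in at_top. \<bar>(b * x) ^ k * exp (- (x * a)\<^sup>2 / 2)\<bar> \<le> (\<bar>b\<bar> / ?m) ^ k * ((?m * x) ^ k / exp (?m * x))"
      using eventually_ge_at_top[of 1]
    proof eventually_elim
      case (elim x)
      \<comment> \<open>For x \<ge> 1 the quadratic exponent dominates a linear one, which reduces
        the claim to x^k / exp x.\<close>
      have "?m * x \<le> (x * a)\<^sup>2 / 2"
        using elim assms by (simp add: power_mult_distrib power2_eq_square mult_le_cancel_right1)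
      then have "exp (- (x * a)\<^sup>2 / 2) \<le> exp (- (?m * x))"
        by (subst exp_le_cancel_iff) linarith
      also have "exp (- (?m * x)) = 1 / exp (?m * x)"
        by (simp only: exp_minus inverse_eq_divide)
      finally have "exp (- (x * a)\<^sup>2 / 2) \<le> 1 / exp (?m * x)" .
      then have "(\<bar>b\<bar> * x) ^ k * exp (- (x * a)\<^sup>2 / 2) \<le> (\<bar>b\<bar> * x) ^ k * (1 / exp (?m * x))"
        using elim by (intro mult_left_mono) auto
      moreover have "(\<bar>b\<bar> / ?m) ^ k * ((?m * x) ^ k / exp (?m * x)) = (\<bar>b\<bar> * x) ^ k * (1 / exp (?m * x))"
      proof -
        have "\<bar>b\<bar> / ?m * (?m * x) = \<bar>b\<bar> * x" using assms by simp
        then show ?thesis by (metis power_mult_distrib times_divide_eq_right mult.right_neutral)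
      qed
      moreover have "\<bar>(b * x) ^ k * exp (- (x * a)\<^sup>2 / 2)\<bar> = (\<bar>b\<bar> * x) ^ k * exp (- (x * a)\<^sup>2 / 2)"
        using elim by (simp add: abs_mult power_abs)
      ultimately show ?case by (simp only:)
    qed
    have "filterlim (\<lambda>x. ?m * x) at_top at_top"
      using assms by (intro filterlim_tendsto_pos_mult_at_top[OF tendsto_const]) (auto simp: filterlim_ident)
    from filterlim_compose[OF tendsto_power_div_exp_0 this, of k]
    show "((\<lambda>x. (\<bar>b\<bar> / ?m) ^ k * ((?m * x) ^ k / exp (?m * x))) \<longlongrightarrow> 0) at_top"
      by (rule tendsto_mult_right_zero)
  qed auto
  from filterlim_compose[OF this filterlim_compose[OF filterlim_real_sequentially filterlim_Suc]]
  show ?thesis .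
qed

text \<open>Fourier inversion at a point near which \<open>\<psi>\<close> vanishes. With the Gaussian cut-offs no decay of
  the Fourier transform is needed.\<close>

lemma gaussian_cutoff_fourier_tendsto_0:
  fixes \<psi> :: "'a::euclidean_space \<Rightarrow> complex"
  assumes \<psi>: "integrable lborel \<psi>" and "0 < \<rho>"
    and vanish: "\<And>y. dist y (- \<nu>) < \<rho> \<Longrightarrow> \<psi> y = 0"
  shows "(\<lambda>n. \<integral>x. complex_of_real (exp (- (norm x / real (Suc n))\<^sup>2 / 2)) * (iexp (x \<bullet> (2 * pi) *\<^sub>R \<nu>) * fourier \<psi> x) \<partial>lborel)
    \<longlonglongrightarrow> 0"
    and "\<And>c. 0 < c \<Longrightarrow> integrable lborel (\<lambda>x. complex_of_real (exp (- (norm x / c)\<^sup>2 / 2)) * (iexp (x \<bullet> (2 * pi) *\<^sub>R \<nu>) * fourier \<psi> x))"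
proof -
  have [measurable]: "\<psi> \<in> borel_measurable borel" using \<psi> by auto
  define h where "h c x = complex_of_real (exp (- (norm x / c)\<^sup>2 / 2))" for c and x :: 'a
  define F where "F c = (\<lambda>(x, y). h c x * iexp (x \<bullet> (2 * pi) *\<^sub>R \<nu>) * (\<psi> y * iexp (x \<bullet> (2 * pi) *\<^sub>R y)))" for c
  have hm[measurable]: "h c \<in> borel_measurable borel" for c unfolding h_def by measurable
  have hi: "integrable lborel (h c)" if "0 < c" for c
    unfolding h_def using gaussian_integrable[OF that] by (rule integrable_of_real)
  have four: "fourier \<psi> x = (\<integral>y. \<psi> y * iexp (x \<bullet> (2 * pi) *\<^sub>R y) \<partial>lborel)" for x
    unfolding fourier_def by (intro Bochner_Integration.integral_cong) (simp_all add: mult_ac inner_commute)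
  have Fm[measurable]: "F c \<in> borel_measurable (lborel \<Otimes>\<^sub>M lborel)" for c
    unfolding F_def by measurable
  have inner: "(\<integral>y. F c (x, y) \<partial>lborel) = h c x * (iexp (x \<bullet> (2 * pi) *\<^sub>R \<nu>) * fourier \<psi> x)" for c x
    by (simp add: F_def four)
  have Fint: "integrable (lborel \<Otimes>\<^sub>M lborel) (F c)" if "0 < c" for c
  proof (rule lborel_pair.Fubini_integrable)
    have "(\<integral>y. norm (F c (x, y)) \<partial>lborel) = norm (h c x) * (\<integral>y. norm (\<psi> y) \<partial>lborel)" for x
      by (simp add: F_def norm_mult)
    then show "integrable lborel (\<lambda>x. \<integral>y. norm (F c (x, y)) \<partial>lborel)"
      using hi[OF that] by simp
    have "integrable lborel (\<lambda>y. F c (x, y))" for x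
    proof (rule Bochner_Integration.integrable_bound)
      show "integrable lborel (\<lambda>y. h c x * \<psi> y)" using \<psi> by simp
    qed (auto simp: F_def norm_mult)
    then show "AE x in lborel. integrable lborel (\<lambda>y. F c (x, y))" by simp
  qed simp
  show "\<And>c. 0 < c \<Longrightarrow> integrable lborel (\<lambda>x. complex_of_real (exp (- (norm x / c)\<^sup>2 / 2)) * (iexp (x \<bullet> (2 * pi) *\<^sub>R \<nu>) * fourier \<psi> x))"
    using lborel_pair.integrable_fst'[OF Fint] unfolding inner unfolding h_def .
  \<comment> \<open>\<open>K c\<close> bounds the shifted transform of the Gaussian at distance at
    least \<rho> from - \<nu>, which is where \<psi> may differ from 0.\<close>
  define K where "K c = (sqrt (2 * pi) * c) ^ DIM('a) * exp (- (c * (2 * pi * \<rho>))\<^sup>2 / 2)" for c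
  have bound: "norm (\<integral>x. h c x * (iexp (x \<bullet> (2 * pi) *\<^sub>R \<nu>) * fourier \<psi> x) \<partial>lborel) \<le> K c * (\<integral>y. norm (\<psi> y) \<partial>lborel)"
    if "0 < c" for c
  proof -
    have "(\<integral>x. h c x * (iexp (x \<bullet> (2 * pi) *\<^sub>R \<nu>) * fourier \<psi> x) \<partial>lborel) = (\<integral>x. \<integral>y. F c (x, y) \<partial>lborel \<partial>lborel)"
      by (simp add: inner)
    \<comment> \<open>After the exchange, \<psi> itself is integrated against the transform of the
      Gaussian, a peak at - \<nu>, where \<psi> vanishes.\<close>
    also have "\<dots> = (\<integral>y. \<integral>x. F c (x, y) \<partial>lborel \<partial>lborel)"
      using Fint[OF that] by (intro lborel_pair.Fubini_integral[symmetric]) simp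
    also have "\<dots> = (\<integral>y. \<psi> y * complex_of_real ((sqrt (2 * pi) * c) ^ DIM('a) * exp (- (c * norm ((2 * pi) *\<^sub>R (y + \<nu>)))\<^sup>2 / 2)) \<partial>lborel)"
    proof (intro Bochner_Integration.integral_cong refl)
      fix y
      have "F c (x, y) = \<psi> y * (complex_of_real (exp (- (norm x / c)\<^sup>2 / 2)) * iexp (x \<bullet> (2 * pi) *\<^sub>R (y + \<nu>)))" for x
        by (simp add: F_def h_def inner_add_right distrib_left exp_add mult_ac)
      then show "(\<integral>x. F c (x, y) \<partial>lborel) = \<psi> y * complex_of_real ((sqrt (2 * pi) * c) ^ DIM('a) * exp (- (c * norm ((2 * pi) *\<^sub>R (y + \<nu>)))\<^sup>2 / 2))"
        by (simp only: integral_mult_right_zero gaussian_fourier[OF that])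
    qed
    also have "norm \<dots> \<le> (\<integral>y. K c * norm (\<psi> y) \<partial>lborel)"
    proof (rule Bochner_Integration.integral_norm_bound_integral)
      have le: "norm (\<psi> y * complex_of_real ((sqrt (2 * pi) * c) ^ DIM('a) * exp (- (c * norm ((2 * pi) *\<^sub>R (y + \<nu>)))\<^sup>2 / 2))) \<le> K c * norm (\<psi> y)" for y
      proof (cases "dist y (- \<nu>) < \<rho>")
        case False
        then have "(c * (2 * pi * \<rho>))\<^sup>2 \<le> (c * norm ((2 * pi) *\<^sub>R (y + \<nu>)))\<^sup>2"
          using that \<open>0 < \<rho>\<close> by (intro power_mono mult_left_mono) (auto simp: dist_norm)
        then have "(sqrt (2 * pi) * c) ^ DIM('a) * exp (- (c * norm ((2 * pi) *\<^sub>R (y + \<nu>)))\<^sup>2 / 2) \<le> K c"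
          unfolding K_def using that by (intro mult_left_mono) auto
        moreover have "0 \<le> (sqrt (2 * pi) * c) ^ DIM('a) * exp (- (c * norm ((2 * pi) *\<^sub>R (y + \<nu>)))\<^sup>2 / 2)"
          using that by simp
        ultimately show ?thesis
          unfolding norm_mult norm_of_real by (subst mult.commute) (intro mult_right_mono, auto)
      qed (simp add: vanish)
      then show "\<And>y. y \<in> space lborel \<Longrightarrow> norm (\<psi> y * complex_of_real ((sqrt (2 * pi) * c) ^ DIM('a) * exp (- (c * norm ((2 * pi) *\<^sub>R (y + \<nu>)))\<^sup>2 / 2))) \<le> K c * norm (\<psi> y)" by blast
      show i: "integrable lborel (\<lambda>y. K c * norm (\<psi> y))" using \<psi> by simp
      show "integrable lborel (\<lambda>y. \<psi> y * complex_of_real ((sqrt (2 * pi) * c) ^ DIM('a) * exp (- (c * norm ((2 * pi) *\<^sub>R (y + \<nu>)))\<^sup>2 / 2)))"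
        by (rule Bochner_Integration.integrable_bound[OF i]) (measurable, intro AE_I2 order_trans[OF le], simp)
    qed
    finally show ?thesis by simp
  qed
  have "(\<lambda>n. K (real (Suc n))) \<longlonglongrightarrow> 0"
    unfolding K_def using \<open>0 < \<rho>\<close> by (intro power_times_gaussian_tendsto_0) simp
  then have "(\<lambda>n. K (real (Suc n)) * (\<integral>y. norm (\<psi> y) \<partial>lborel)) \<longlonglongrightarrow> 0"
    by (rule tendsto_mult_left_zero)
  then show "(\<lambda>n. \<integral>x. complex_of_real (exp (- (norm x / real (Suc n))\<^sup>2 / 2)) * (iexp (x \<bullet> (2 * pi) *\<^sub>R \<nu>) * fourier \<psi> x) \<partial>lborel) \<longlonglongrightarrow> 0"
  proof (rule Lim_null_comparison[OF always_eventually, rotated], intro allI)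
    fix n show "norm (\<integral>x. complex_of_real (exp (- (norm x / real (Suc n))\<^sup>2 / 2)) * (iexp (x \<bullet> (2 * pi) *\<^sub>R \<nu>) * fourier \<psi> x) \<partial>lborel)
        \<le> K (real (Suc n)) * (\<integral>y. norm (\<psi> y) \<partial>lborel)"
      using bound[of "real (Suc n)"] unfolding h_def by (simp only: of_nat_0_less_iff zero_less_Suc)
  qed
qed

text \<open>If the integrand is not integrable, the Bochner integral is 0 by convention.\<close>

lemma integral_trig_poly_fourier_eq_0:
  fixes \<psi> :: "'a::euclidean_space \<Rightarrow> complex" and \<nu> :: "'i \<Rightarrow> 'a"
  assumes \<psi>: "integrable lborel \<psi>" and "finite I"
    and vanish: "\<And>i. i \<in> I \<Longrightarrow> \<exists>\<rho>>0. \<forall>y. dist y (- \<nu> i) < \<rho> \<longrightarrow> \<psi> y = 0"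
  shows "(\<integral>x. (\<Sum>i\<in>I. c i * iexp (x \<bullet> (2 * pi) *\<^sub>R \<nu> i)) * fourier \<psi> x \<partial>lborel) = 0"
proof -
  define f where "f x = (\<Sum>i\<in>I. c i * iexp (x \<bullet> (2 * pi) *\<^sub>R \<nu> i))" for x
  define h where "h n x = complex_of_real (exp (- (norm x / real (Suc n))\<^sup>2 / 2))" for n and x :: 'a
  have "(\<integral>x. f x * fourier \<psi> x \<partial>lborel) = 0"
  proof (cases "integrable lborel (\<lambda>x. f x * fourier \<psi> x)")
    case True
    have hm[measurable]: "h n \<in> borel_measurable borel" for n unfolding h_def by measurable
    have h1: "(\<lambda>n. h n x) \<longlonglongrightarrow> 1" for x
    proof -
      have "(\<lambda>n. norm x / real (Suc n)) \<longlonglongrightarrow> 0"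
        by (rule real_tendsto_divide_at_top[OF tendsto_const filterlim_compose[OF filterlim_real_sequentially filterlim_Suc]])
      then have "(\<lambda>n. h n x) \<longlonglongrightarrow> complex_of_real (exp (- 0\<^sup>2 / 2))"
        unfolding h_def by (intro tendsto_intros) auto
      then show ?thesis by simp
    qed
    have "(\<lambda>n. \<integral>x. h n x * (f x * fourier \<psi> x) \<partial>lborel) \<longlonglongrightarrow> (\<integral>x. f x * fourier \<psi> x \<partial>lborel)"
    proof (rule integral_dominated_convergence[where w="\<lambda>x. norm (f x * fourier \<psi> x)"])
      show "AE x in lborel. (\<lambda>n. h n x * (f x * fourier \<psi> x)) \<longlonglongrightarrow> f x * fourier \<psi> x"
        using tendsto_mult_right[OF h1] by (intro AE_I2) simp
      show "AE x in lborel. norm (h n x * (f x * fourier \<psi> x)) \<le> norm (f x * fourier \<psi> x)" for n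
        by (intro AE_I2) (simp add: norm_mult h_def mult_left_le_one_le)
    qed (use True in auto)
    \<comment> \<open>The cut-off also makes each single exponential integrable against the
      transform; without it only the whole sum is known to be.\<close>
    moreover have "(\<lambda>n. \<integral>x. h n x * (f x * fourier \<psi> x) \<partial>lborel) \<longlonglongrightarrow> (\<Sum>i\<in>I. c i * 0)"
    proof -
      have int: "integrable lborel (\<lambda>x. h n x * (iexp (x \<bullet> (2 * pi) *\<^sub>R \<nu> i) * fourier \<psi> x))" if "i \<in> I" for i n
        using vanish[OF that] gaussian_cutoff_fourier_tendsto_0(2)[OF \<psi>, of _ "\<nu> i" "real (Suc n)"]
        unfolding h_def by auto
      have "(\<integral>x. h n x * (f x * fourier \<psi> x) \<partial>lborel)
          = (\<Sum>i\<in>I. c i * (\<integral>x. h n x * (iexp (x \<bullet> (2 * pi) *\<^sub>R \<nu> i) * fourier \<psi> x) \<partial>lborel))" for n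
      proof -
        have "(\<integral>x. h n x * (f x * fourier \<psi> x) \<partial>lborel)
          = (\<integral>x. (\<Sum>i\<in>I. c i * (h n x * (iexp (x \<bullet> (2 * pi) *\<^sub>R \<nu> i) * fourier \<psi> x))) \<partial>lborel)"
          by (intro Bochner_Integration.integral_cong) (simp_all add: f_def sum_distrib_left sum_distrib_right mult_ac)
        also have "\<dots> = (\<Sum>i\<in>I. (\<integral>x. c i * (h n x * (iexp (x \<bullet> (2 * pi) *\<^sub>R \<nu> i) * fourier \<psi> x)) \<partial>lborel))"
          by (intro Bochner_Integration.integral_sum integrable_mult_right int)
        finally show ?thesis by (simp only: integral_mult_right_zero)
      qed
      moreover have "(\<lambda>n. \<Sum>i\<in>I. c i * (\<integral>x. h n x * (iexp (x \<bullet> (2 * pi) *\<^sub>R \<nu> i) * fourier \<psi> x) \<partial>lborel)) \<longlonglongrightarrow> (\<Sum>i\<in>I. c i * 0)"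
      proof (intro tendsto_sum tendsto_mult tendsto_const)
        fix i assume "i \<in> I"
        from vanish[OF this] obtain \<rho> where "\<rho> > 0" "\<And>y. dist y (- \<nu> i) < \<rho> \<Longrightarrow> \<psi> y = 0" by auto
        from gaussian_cutoff_fourier_tendsto_0(1)[OF \<psi> this]
        show "(\<lambda>n. \<integral>x. h n x * (iexp (x \<bullet> (2 * pi) *\<^sub>R \<nu> i) * fourier \<psi> x) \<partial>lborel) \<longlonglongrightarrow> 0"
          unfolding h_def .
      qed
      ultimately show ?thesis by simp
    qed
    ultimately have "(\<integral>x. f x * fourier \<psi> x \<partial>lborel) = (\<Sum>i\<in>I. c i * 0)" by (rule LIMSEQ_unique)
    then show ?thesis by simp
  qed (rule not_integrable_integral_eq)
  then show ?thesis by (simp only: f_def)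
qed

text \<open>With the positive sign in the exponent of \<open>fourier\<close>, exp (2 pi i <x,\<nu>>)
  transforms to the point mass at - \<nu>. A finite set is closed, so it suffices that the
  distribution vanishes on its complement.\<close>

lemma distr_support_trig_poly:
  fixes \<nu> :: "'i \<Rightarrow> 'a::euclidean_space"
  assumes "finite I"
  shows "distr_support (distr_fourier (distr_of (\<lambda>x. \<Sum>i\<in>I. c i * iexp (x \<bullet> (2 * pi) *\<^sub>R \<nu> i)))) \<subseteq> (\<lambda>i. - \<nu> i) ` I"
proof -
  let ?U = "- (\<lambda>i. - \<nu> i) ` I"
  let ?f = "\<lambda>x. \<Sum>i\<in>I. c i * iexp (x \<bullet> (2 * pi) *\<^sub>R \<nu> i)"
  have "open ?U" using assms by (intro open_Compl finite_imp_closed) auto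
  moreover have "distr_vanishes_on (distr_fourier (distr_of ?f)) ?U"
    unfolding distr_vanishes_on_def
  proof (intro allI impI)
    fix \<psi> :: "'a \<Rightarrow> complex"
    assume *: "schwartz \<psi> \<and> compact (closure {x. \<psi> x \<noteq> 0}) \<and> closure {x. \<psi> x \<noteq> 0} \<subseteq> ?U"
    then have "partials [] \<psi> differentiable at x" for x
      unfolding schwartz_def smooth_def by blast
    then have "continuous_on UNIV \<psi>"
      by (intro differentiable_imp_continuous_on) (simp add: differentiable_on_def differentiable_at_withinI)
    then have int: "integrable lborel \<psi>" using * by (intro integrable_continuous_compact_support) auto
    have van: "\<exists>\<rho>>0. \<forall>y. dist y (- \<nu> i) < \<rho> \<longrightarrow> \<psi> y = 0" if "i \<in> I" for i
    proof -
      have "- \<nu> i \<in> - closure {x. \<psi> x \<noteq> 0}" using * that by auto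
      then obtain \<rho> where \<rho>: "\<rho> > 0" "ball (- \<nu> i) \<rho> \<subseteq> - closure {x. \<psi> x \<noteq> 0}"
        by (meson openE open_Compl closed_closure)
      have "\<psi> y = 0" if "dist y (- \<nu> i) < \<rho>" for y
      proof (rule ccontr)
        assume "\<psi> y \<noteq> 0"
        then have "y \<in> closure {x. \<psi> x \<noteq> 0}" by (intro subsetD[OF closure_subset]) simp
        moreover have "y \<in> ball (- \<nu> i) \<rho>" using that by (simp add: dist_commute)
        ultimately show False using \<rho>(2) by blast
      qed
      then show ?thesis using \<rho>(1) by blast
    qed
    show "distr_fourier (distr_of ?f) \<psi> = 0"
      unfolding distr_fourier_def distr_of_def
      by (rule integral_trig_poly_fourier_eq_0[OF int assms van])
  qed
  ultimately show ?thesis unfolding distr_support_def by blast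
qed

section \<open>Discretisation of the unit ball\<close>

text \<open>The ball is cut into cells contained in balls of radius \<eta>, and the volume of each
  cell is placed at the centre; a function with Lipschitz constant L deviates by at most \<eta> L on
  a cell. The same nodes serve all functions, since they will be used for |<x,u>| with every
  \<open>u\<close> at once.\<close>

lemma cball_quadrature:
  assumes "0 < \<eta>"
  shows "\<exists>(n::nat) (c :: nat \<Rightarrow> 'a::euclidean_space) (m :: nat \<Rightarrow> real).
    (\<forall>i. 0 \<le> m i) \<and> (\<Sum>i<n. m i) = unit_ball_vol (real DIM('a)) \<and>
    (\<forall>(g :: 'a \<Rightarrow> real) L. (\<forall>x y. \<bar>g x - g y\<bar> \<le> L * dist x y) \<longrightarrow>
      \<bar>(\<Sum>i<n. m i * g (c i)) - (\<integral>x. indicator (cball 0 1) x *\<^sub>R g x \<partial>lborel)\<bar> \<le> \<eta> * L * unit_ball_vol (real DIM('a)))"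
proof -
  let ?B = "cball (0::'a) 1" let ?\<omega> = "unit_ball_vol (real DIM('a))"
  obtain K where K: "finite K" "?B \<subseteq> (\<Union>c\<in>K. ball c \<eta>)"
    using compactE_image[of ?B ?B "\<lambda>c. ball c \<eta>"] assms by (metis UN_I centre_in_ball compact_cball open_ball subsetI)
  obtain c where c: "bij_betw c {0..<card K} K" using ex_bij_betw_nat_finite[OF K(1)] by blast
  define n where "n = card K"
  define A where "A i = ?B \<inter> ball (c i) \<eta> - (\<Union>j<i. ball (c j) \<eta>)" for i
  define m where "m i = measure lborel (A i)" for i
  have Ab[measurable]: "A i \<in> sets borel" for i unfolding A_def by measurable
  have Afin: "emeasure lborel (A i) < \<infinity>" for i
    using emeasure_mono[of "A i" ?B lborel] emeasure_lborel_cball_finite[of "0::'a" 1] by (force simp: A_def)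
  have disj: "disjoint_family_on A {..<n}"
    unfolding disjoint_family_on_def A_def by (auto simp: neq_iff)
  have un: "(\<Union>i<n. A i) = ?B"
  proof
    show "?B \<subseteq> (\<Union>i<n. A i)"
    proof
      fix x assume x: "x \<in> ?B"
      have "\<exists>i. i < n \<and> x \<in> ball (c i) \<eta>"
      proof -
        obtain k where "k \<in> K" "x \<in> ball k \<eta>" using x K(2) by blast
        moreover have "K = c ` {0..<n}" using c by (simp add: bij_betw_def n_def)
        ultimately show ?thesis by auto
      qed
      then obtain i where "i < n \<and> x \<in> ball (c i) \<eta>" "\<And>j. j < i \<Longrightarrow> \<not> (j < n \<and> x \<in> ball (c j) \<eta>)"
        using exists_least_iff[of "\<lambda>i. i < n \<and> x \<in> ball (c i) \<eta>"] by blast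
      then have "i < n" "x \<in> A i" using x by (auto simp: A_def)
      then show "x \<in> (\<Union>i<n. A i)" by blast
    qed
  qed (auto simp: A_def)
  have ind: "indicator ?B x = (\<Sum>i<n. indicator (A i) x :: real)" for x
    using indicator_UN_disjoint[OF _ disj, of x] by (simp add: un)
  show ?thesis
  proof (intro exI[of _ n] exI[of _ c] exI[of _ m] conjI allI impI)
    have "(\<Sum>i<n. m i) = measure lborel (\<Union>i<n. A i)"
      unfolding m_def using disj Afin by (intro measure_finite_Union[symmetric]) (auto simp: top.not_eq_extremum)
    then show "(\<Sum>i<n. m i) = ?\<omega>" by (simp add: un content_cball)
    show "0 \<le> m i" for i by (simp add: m_def)
    fix g :: "'a \<Rightarrow> real" and L assume "\<forall>x y. \<bar>g x - g y\<bar> \<le> L * dist x y"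
    then have lip: "\<bar>g x - g y\<bar> \<le> L * dist x y" for x y by blast
    have "0 \<le> L"
    proof -
      obtain b :: 'a where "b \<in> Basis" using nonempty_Basis by blast
      then show ?thesis using lip[of b 0] by (simp add: order_trans[OF abs_ge_zero])
    qed
    have cont: "continuous_on UNIV g"
    proof (rule lipschitz_on_continuous_on)
      show "L-lipschitz_on UNIV g" using lip \<open>0 \<le> L\<close> by (intro lipschitz_onI) (auto simp: dist_real_def)
    qed
    then have [measurable]: "g \<in> borel_measurable borel" by (rule borel_measurable_continuous_onI)
    have "integrable lborel (\<lambda>x. indicator ?B x *\<^sub>R g x)"
      by (intro borel_integrable_compact continuous_on_subset[OF cont]) auto
    then have "integrable lborel (\<lambda>x. indicator (A i) x *\<^sub>R (indicator ?B x *\<^sub>R g x))" for i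
      by (rule integrable_mult_indicator[rotated]) simp
    moreover have "indicator (A i) x *\<^sub>R (indicator ?B x *\<^sub>R g x) = indicator (A i) x *\<^sub>R g x" for i x
      by (auto simp: A_def indicator_def)
    ultimately have int: "integrable lborel (\<lambda>x. indicator (A i) x *\<^sub>R g x)" for i by (simp only:)
    have inti: "integrable lborel (indicator (A i) :: 'a \<Rightarrow> real)" for i
      using Afin by (intro integrable_real_indicator) auto
    have "(\<integral>x. indicator ?B x *\<^sub>R g x \<partial>lborel) = (\<Sum>i<n. \<integral>x. indicator (A i) x *\<^sub>R g x \<partial>lborel)"
      using int by (subst Bochner_Integration.integral_sum[symmetric]) (simp_all add: ind sum_distrib_right)
    then have "\<bar>(\<Sum>i<n. m i * g (c i)) - (\<integral>x. indicator ?B x *\<^sub>R g x \<partial>lborel)\<bar>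
        = \<bar>\<Sum>i<n. m i * g (c i) - (\<integral>x. indicator (A i) x *\<^sub>R g x \<partial>lborel)\<bar>"
      by (simp add: sum_subtractf)
    also have "\<dots> \<le> (\<Sum>i<n. \<eta> * L * m i)"
    proof (intro order_trans[OF sum_abs] sum_mono)
      fix i
      have "m i * g (c i) - (\<integral>x. indicator (A i) x *\<^sub>R g x \<partial>lborel)
          = (\<integral>x. indicator (A i) x * g (c i) - indicator (A i) x *\<^sub>R g x \<partial>lborel)"
        using int inti by (subst Bochner_Integration.integral_diff) (auto simp: m_def)
      also have "norm \<dots> \<le> (\<integral>x. indicator (A i) x * (\<eta> * L) \<partial>lborel)"
      proof (rule Bochner_Integration.integral_norm_bound_integral)
        fix x
        have "\<bar>g (c i) - g x\<bar> \<le> \<eta> * L" if "x \<in> A i"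
        proof -
          have "\<bar>g (c i) - g x\<bar> \<le> L * dist (c i) x" by (rule lip)
          also have "\<dots> \<le> L * \<eta>" using that \<open>0 \<le> L\<close> by (intro mult_left_mono) (auto simp: A_def)
          finally show ?thesis by (simp add: mult.commute)
        qed
        then show "norm (indicator (A i) x * g (c i) - indicator (A i) x *\<^sub>R g x) \<le> indicator (A i) x * (\<eta> * L)"
          by (simp add: indicator_def)
      qed (use int inti in auto)
      also have "\<dots> = \<eta> * L * m i" by (simp add: m_def)
      finally show "\<bar>m i * g (c i) - (\<integral>x. indicator (A i) x *\<^sub>R g x \<partial>lborel)\<bar> \<le> \<eta> * L * m i" by simp
    qed
    also have "\<dots> = \<eta> * L * ?\<omega>"
      using \<open>(\<Sum>i<n. m i) = ?\<omega>\<close> by (simp add: sum_distrib_left[symmetric])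
    finally show "\<bar>(\<Sum>i<n. m i * g (c i)) - (\<integral>x. indicator ?B x *\<^sub>R g x \<partial>lborel)\<bar> \<le> \<eta> * L * ?\<omega>" .
  qed
qed

lemma span_singleton_sym:
  fixes x y :: "'a::real_vector"
  assumes "x \<in> span {y}" "x \<noteq> 0"
  shows "y \<in> span {x}"
proof -
  obtain k where k: "x = k *\<^sub>R y" using assms(1) by (auto simp: span_singleton)
  then have "y = inverse k *\<^sub>R x" using assms(2) by auto
  then show ?thesis by (metis span_base span_scale singletonI)
qed

text \<open>The vectors to be avoided lie on finitely many lines through 0, a null set since d \<ge>
  2. Parallel vectors are excluded because no translation shifts the hyperplanes of one while fixing
  those of the other.\<close>

lemma nonparallel_perturbation:
  fixes y :: "nat \<Rightarrow> 'a::euclidean_space"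
  assumes "2 \<le> DIM('a)" "0 < \<eta>"
  shows "\<exists>z. \<forall>i<n. dist (z i) (y i) < \<eta> \<and> z i \<noteq> 0 \<and> (\<forall>j<n. j \<noteq> i \<longrightarrow> z i \<notin> span {z j})"
proof (induction n)
  case (Suc n)
  then obtain z where z: "\<And>i. i < n \<Longrightarrow> dist (z i) (y i) < \<eta> \<and> z i \<noteq> 0 \<and> (\<forall>j<n. j \<noteq> i \<longrightarrow> z i \<notin> span {z j})"
    by blast
  let ?S = "insert 0 (\<Union>i<n. span {z i})"
  have "negligible (span {v})" for v :: 'a
  proof (rule negligible_lowdim)
    have "dim (span {v}) \<le> card {v}" by (intro dim_le_card) auto
    then show "dim (span {v}) < DIM('a)" using assms(1) by simp
  qed
  then have "negligible ?S" unfolding negligible_insert by (intro negligible_Union) auto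
  then have "\<not> ball (y n) \<eta> \<subseteq> ?S"
    using negligible_subset open_not_negligible[of "ball (y n) \<eta>"] assms(2) by (metis ball_eq_empty not_le open_ball)
  then obtain w where "w \<in> ball (y n) \<eta>" "w \<notin> ?S" by blast
  then have w: "dist w (y n) < \<eta>" "w \<noteq> 0" "\<And>i. i < n \<Longrightarrow> w \<notin> span {z i}"
    by (auto simp: dist_commute)
  have w': "z i \<notin> span {w}" if "i < n" for i
    using span_singleton_sym[of "z i" w] z[OF that] w(3)[OF that] by blast
  show ?case
    using z w w' by (intro exI[of _ "z(n := w)"]) (auto simp: less_Suc_eq)
qed simp

text \<open>The vectors are the nodes times their masses, scaled so that the zonotope condition
  holds; the sum of their lengths is then close to 2 \<open>I1\<close> / \<open>I2\<close>, where
  \<open>I1\<close> and \<open>I2\<close> are the integrals of |x| and |x_1| over the ball.\<close>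

lemma exists_direction_system:
  fixes t :: real
  assumes dim: "DIM('b::euclidean_space) + 1 = DIM('a::euclidean_space)" and "2 \<le> DIM('a)"
    and t: "t < real DIM('a) * (unit_ball_vol (real DIM('a)) / unit_ball_vol (real DIM('b)))"
  obtains V :: "'a::euclidean_space set" where "finite V" "0 \<notin> V" "\<And>v w. v \<in> V \<Longrightarrow> w \<in> V \<Longrightarrow> v \<noteq> w \<Longrightarrow> w \<notin> span {v}"
    "\<And>u. (\<Sum>v\<in>V. \<bar>v \<bullet> u\<bar>) \<le> 2 * norm u" "t < (\<Sum>v\<in>V. norm v)"
proof -
  define \<omega> where "\<omega> = unit_ball_vol (real DIM('a))"
  define I1 where "I1 = real DIM('a) / (real DIM('a) + 1) * \<omega>"
  define I2 where "I2 = 2 / (real DIM('a) + 1) * unit_ball_vol (real DIM('b))"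
  have "0 < I2" "0 < \<omega>" by (simp_all add: I2_def \<omega>_def)
  have J1: "(\<integral>x. indicator (cball (0::'a) 1) x *\<^sub>R norm x \<partial>lborel) = I1"
  proof -
    have "(\<integral>x. indicator (cball (0::'a) 1) x *\<^sub>R norm x \<partial>lborel)
        = enn2real (\<integral>\<^sup>+x. ennreal (indicator (cball (0::'a) 1) x *\<^sub>R norm x) \<partial>lborel)"
      by (rule integral_eq_nn_integral) (intro borel_measurable_scaleR borel_measurable_indicator, auto)
    also have "(\<integral>\<^sup>+x. ennreal (indicator (cball (0::'a) 1) x *\<^sub>R norm x) \<partial>lborel) = (\<integral>\<^sup>+x\<in>cball 0 1. ennreal (norm x) \<partial>(lborel :: 'a measure))"
      by (intro nn_integral_cong) (auto simp: indicator_def)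
    finally show ?thesis unfolding nn_integral_cball_norm by (simp add: I1_def \<omega>_def)
  qed
  have J2: "(\<integral>x. indicator (cball (0::'a) 1) x *\<^sub>R \<bar>x \<bullet> u\<bar> \<partial>lborel) = I2 * norm u" for u
  proof -
    have "(\<integral>x. indicator (cball (0::'a) 1) x *\<^sub>R \<bar>x \<bullet> u\<bar> \<partial>lborel)
        = enn2real (\<integral>\<^sup>+x. ennreal (indicator (cball (0::'a) 1) x *\<^sub>R \<bar>x \<bullet> u\<bar>) \<partial>lborel)"
      by (rule integral_eq_nn_integral) (intro borel_measurable_scaleR borel_measurable_indicator, auto)
    also have "(\<integral>\<^sup>+x. ennreal (indicator (cball (0::'a) 1) x *\<^sub>R \<bar>x \<bullet> u\<bar>) \<partial>lborel) = (\<integral>\<^sup>+x\<in>cball 0 1. ennreal \<bar>x \<bullet> u\<bar> \<partial>lborel)"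
      by (intro nn_integral_cong) (auto simp: indicator_def)
    finally show ?thesis unfolding nn_integral_cball_inner[OF dim] by (simp add: I2_def)
  qed
  \<comment> \<open>Lower bound for the sum of lengths when both moments carry an error 2 \<eta>
    \<omega>; as \<eta> goes to 0 it tends to the ideal value.\<close>
  have "((\<lambda>\<eta>. 2 * (I1 - 2 * \<eta> * \<omega>) / (I2 + 2 * \<eta> * \<omega>)) \<longlongrightarrow> 2 * (I1 - 2 * 0 * \<omega>) / (I2 + 2 * 0 * \<omega>)) (at_right 0)"
    using \<open>0 < I2\<close> by (intro tendsto_intros) auto
  moreover have "t < 2 * (I1 - 2 * 0 * \<omega>) / (I2 + 2 * 0 * \<omega>)"
  proof -
    have "2 * I1 / I2 = real DIM('a) * (\<omega> / unit_ball_vol (real DIM('b)))"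
    proof -
      have eq: "2 * (p / q * r) / (2 / q * s) = p * (r / s)" if "0 < q" "0 < s" for p q r s :: real
        using that by (simp add: field_simps)
      show ?thesis unfolding I1_def I2_def by (rule eq) auto
    qed
    then show ?thesis using t by (simp add: \<omega>_def)
  qed
  ultimately have "\<forall>\<^sub>F \<eta> in at_right 0. t < 2 * (I1 - 2 * \<eta> * \<omega>) / (I2 + 2 * \<eta> * \<omega>)"
    by (rule order_tendstoD)
  then obtain e where "0 < e" "\<And>\<eta>. 0 < \<eta> \<Longrightarrow> \<eta> < e \<Longrightarrow> t < 2 * (I1 - 2 * \<eta> * \<omega>) / (I2 + 2 * \<eta> * \<omega>)"
    unfolding eventually_at_right_field by blast
  then obtain \<eta> where \<eta>: "0 < \<eta>" "t < 2 * (I1 - 2 * \<eta> * \<omega>) / (I2 + 2 * \<eta> * \<omega>)"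
    using dense by blast
  obtain n :: nat and y :: "nat \<Rightarrow> 'a" and m where "\<forall>i. 0 \<le> m i" and m2: "(\<Sum>i<n. m i) = \<omega>"
    and quad: "\<forall>(g :: 'a \<Rightarrow> real) L. (\<forall>x y. \<bar>g x - g y\<bar> \<le> L * dist x y) \<longrightarrow>
      \<bar>(\<Sum>i<n. m i * g (y i)) - (\<integral>x. indicator (cball 0 1) x *\<^sub>R g x \<partial>lborel)\<bar> \<le> \<eta> * L * \<omega>"
    using cball_quadrature[OF \<eta>(1), where 'a='a, folded \<omega>_def] by (elim exE conjE)
  then have m: "0 \<le> m i" for i by blast
  obtain z where z: "\<And>i. i < n \<Longrightarrow> dist (z i) (y i) < \<eta>" "\<And>i. i < n \<Longrightarrow> z i \<noteq> 0"
    "\<And>i j. i < n \<Longrightarrow> j < n \<Longrightarrow> j \<noteq> i \<Longrightarrow> z i \<notin> span {z j}"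
    using nonparallel_perturbation[OF assms(2) \<eta>(1), of n y] by metis
  \<comment> \<open>One \<eta> comes from the quadrature, the other from moving the nodes off common
    lines.\<close>
  have quad': "\<bar>(\<Sum>i<n. m i * g (z i)) - (\<integral>x. indicator (cball 0 1) x *\<^sub>R g x \<partial>lborel)\<bar> \<le> 2 * \<eta> * L * \<omega>"
    if lip: "\<And>x y. \<bar>g x - g y\<bar> \<le> L * dist x y" and "0 \<le> L" for g :: "'a \<Rightarrow> real" and L
  proof -
    have "\<bar>(\<Sum>i<n. m i * g (z i)) - (\<Sum>i<n. m i * g (y i))\<bar> = \<bar>\<Sum>i<n. m i * (g (z i) - g (y i))\<bar>"
      by (simp add: sum_subtractf right_diff_distrib)
    also have "\<dots> \<le> (\<Sum>i<n. m i * (L * \<eta>))"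
    proof (intro order_trans[OF sum_abs] sum_mono)
      fix i assume "i \<in> {..<n}"
      then have "\<bar>g (z i) - g (y i)\<bar> \<le> L * \<eta>"
        using z(1)[of i] \<open>0 \<le> L\<close> by (intro order_trans[OF lip] mult_left_mono) auto
      then show "\<bar>m i * (g (z i) - g (y i))\<bar> \<le> m i * (L * \<eta>)"
        using m by (simp add: abs_mult mult_left_mono)
    qed
    also have "\<dots> = \<eta> * L * \<omega>" by (simp add: sum_distrib_right[symmetric] m2)
    finally show ?thesis using quad[rule_format, of g L, OF lip] by linarith
  qed
  have Q1: "I1 - 2 * \<eta> * \<omega> \<le> (\<Sum>i<n. m i * norm (z i))"
    using quad'[of norm 1] J1 by (simp add: dist_norm norm_triangle_ineq3)
  have Q2: "(\<Sum>i<n. m i * \<bar>z i \<bullet> u\<bar>) \<le> (I2 + 2 * \<eta> * \<omega>) * norm u" for u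
  proof -
    have "\<bar>\<bar>x \<bullet> u\<bar> - \<bar>x' \<bullet> u\<bar>\<bar> \<le> norm u * dist x x'" for x x'
      by (metis Cauchy_Schwarz_ineq2 abs_triangle_ineq3 dist_norm inner_commute inner_diff_right order_trans)
    then show ?thesis using quad'[of "\<lambda>x. \<bar>x \<bullet> u\<bar>" "norm u"] J2[of u] by (simp add: algebra_simps)
  qed
  \<comment> \<open>With this factor the bound in \<open>Q2\<close> becomes exactly 2
    \<open>norm u\<close>.\<close>
  define C where "C = 2 / (I2 + 2 * \<eta> * \<omega>)"
  have "0 < C" using \<open>0 < I2\<close> \<open>0 < \<omega>\<close> \<eta>(1) by (simp add: C_def add_pos_pos)
  \<comment> \<open>A node of mass 0 would give the vector 0.\<close>
  define J where "J = {i. i < n \<and> 0 < m i}"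
  define v where "v i = (C * m i) *\<^sub>R z i" for i
  have J: "finite J" "J \<subseteq> {..<n}" by (auto simp: J_def)
  have pos: "0 < C * m i" if "i \<in> J" for i using that \<open>0 < C\<close> by (simp add: J_def)
  have par: "v j \<notin> span {v i}" if "i \<in> J" "j \<in> J" "i \<noteq> j" for i j
  proof
    assume "v j \<in> span {v i}"
    moreover have "span {v i} \<subseteq> span {z i}"
      unfolding v_def by (intro span_minimal) (auto intro: span_scale span_base)
    ultimately have "v j \<in> span {z i}" by blast
    then have "inverse (C * m j) *\<^sub>R v j \<in> span {z i}" by (rule span_scale)
    moreover have "C * m j \<noteq> 0" using pos[OF that(2)] by (rule less_imp_neq[symmetric])
    then have "inverse (C * m j) *\<^sub>R v j = z j"
      unfolding v_def scaleR_scaleR by (simp only: left_inverse scaleR_one not_False_eq_True)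
    ultimately have "z j \<in> span {z i}" by (simp only:)
    then show False using z(3)[of j i] that J by auto
  qed
  have inj: "inj_on v J"
  proof (rule inj_onI, rule ccontr)
    fix i j assume "i \<in> J" "j \<in> J" "v i = v j" "i \<noteq> j"
    then show False using par[of i j] span_base[of "v j" "{v j}"] by simp
  qed
  have sumJ: "(\<Sum>x\<in>v ` J. G x) = (\<Sum>i<n. C * (m i * G (z i)))"
    if "\<And>k x. 0 \<le> k \<Longrightarrow> G (k *\<^sub>R x) = k * G x" for G :: "'a \<Rightarrow> real"
  proof -
    have "(\<Sum>x\<in>v ` J. G x) = (\<Sum>i\<in>J. C * (m i * G (z i)))"
      unfolding sum.reindex[OF inj] o_def using that pos by (intro sum.cong) (auto simp: v_def less_imp_le)
    also have "\<dots> = (\<Sum>i<n. C * (m i * G (z i)))"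
      using J m by (intro sum.mono_neutral_left) (auto simp: J_def not_less antisym)
    finally show ?thesis .
  qed
  show ?thesis
  proof (rule that[of "v ` J"])
    show "finite (v ` J)" using J by simp
    show "0 \<notin> v ` J"
    proof
      assume "0 \<in> v ` J"
      then obtain i where "i \<in> J" "v i = 0" by auto
      then show False using z(2)[of i] pos[of i] J by (auto simp: v_def)
    qed
    show "w \<notin> span {x}" if "x \<in> v ` J" "w \<in> v ` J" "x \<noteq> w" for x w
      using that par by auto
    have "t < C * (I1 - 2 * \<eta> * \<omega>)" using \<eta>(2) by (simp add: C_def)
    also have "\<dots> \<le> C * (\<Sum>i<n. m i * norm (z i))" using Q1 \<open>0 < C\<close> by (intro mult_left_mono) auto
    also have "\<dots> = (\<Sum>v\<in>v ` J. norm v)" by (subst sumJ) (simp_all add: sum_distrib_left)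
    finally show "t < (\<Sum>v\<in>v ` J. norm v)" .
    fix u
    have "(\<Sum>v\<in>v ` J. \<bar>v \<bullet> u\<bar>) = C * (\<Sum>i<n. m i * \<bar>z i \<bullet> u\<bar>)"
      by (subst sumJ) (simp_all add: sum_distrib_left abs_mult)
    also have "\<dots> \<le> C * ((I2 + 2 * \<eta> * \<omega>) * norm u)" using Q2 \<open>0 < C\<close> by (intro mult_left_mono) auto
    also have "\<dots> = 2 * norm u"
      using \<open>0 < C\<close> by (auto simp: C_def)
    finally show "(\<Sum>v\<in>v ` J. \<bar>v \<bullet> u\<bar>) \<le> 2 * norm u" .
  qed
qed

section \<open>Systems of hyperplanes\<close>

text \<open>Pythagoras: the intersection lies in the ball of the same radius about the foot of the
  perpendicular from \<open>x\<close>, an isometric copy of a ball in \<open>'b\<close>.\<close>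

lemma hausdorff_meas_hyperplane_cball:
  fixes v x :: "'a::euclidean_space"
  assumes "v \<noteq> 0" and dim: "DIM('b::euclidean_space) + 1 = DIM('a)" and "0 \<le> r"
  shows "hausdorff_meas DIM('b) ({y. y \<bullet> v = t} \<inter> cball x r) \<le> ennreal (unit_ball_vol (real DIM('b)) * r ^ DIM('b))"
proof -
  obtain L :: "'b \<Rightarrow> 'a" where L: "linear L" "\<And>z. norm (L z) = norm z" "range L = {y. v \<bullet> y = 0}"
    using orthogonal_complement_isometry[OF assms(1) dim] by metis
  define c where "c = (t - x \<bullet> v) / (v \<bullet> v)"
  define g where "g z = x + c *\<^sub>R v + L z" for z
  have "{y. y \<bullet> v = t} \<inter> cball x r \<subseteq> g ` cball 0 r"
  proof
    fix y assume y: "y \<in> {y. y \<bullet> v = t} \<inter> cball x r"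
    define w where "w = y - (x + c *\<^sub>R v)"
    have w: "v \<bullet> w = 0" using y assms(1) by (simp add: w_def c_def inner_diff_right inner_add_right inner_commute)
    then obtain z where z: "w = L z" using L(3) by auto
    have "(norm w)\<^sup>2 \<le> (norm (w + c *\<^sub>R v))\<^sup>2"
        using norm_add_Pythagorean[of w "c *\<^sub>R v"] w by (simp add: orthogonal_def inner_commute)
    then have "norm w \<le> norm (w + c *\<^sub>R v)" by (simp add: power2_le_iff_abs_le)
    also have "w + c *\<^sub>R v = y - x" by (simp add: w_def)
    finally have "norm z \<le> r" using y z L(2) by (simp add: dist_norm norm_minus_commute)
    moreover have "y = g z" using z by (simp add: g_def w_def diff_eq_eq add.commute)
    ultimately show "y \<in> g ` cball 0 r" by auto
  qed
  moreover have "dist (g a) (g b) \<le> dist a b" for a b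
    by (simp add: g_def dist_norm L(2) linear_diff[OF L(1), symmetric])
  ultimately show ?thesis
    using hausdorff_meas_mono hausdorff_meas_nonexpansive_image_cball[of g r 0] \<open>0 \<le> r\<close> by (meson order_trans)
qed

text \<open>Since \<tau> lies in [0, 1] and \<epsilon> \<le> 1/2, only the integers floor a, floor a
  + 1 and floor a + 2 can occur, each giving an interval of length 2 \<epsilon>. This is the origin
  of the 6 \<epsilon> below; the size of the factor is harmless, as \<epsilon> is chosen
  last.\<close>

lemma emeasure_near_integers_le:
  fixes a \<epsilon> :: real
  assumes "0 < \<epsilon>" "\<epsilon> \<le> 1/2"
  shows "emeasure lborel {\<tau> \<in> {0..1}. \<exists>n::int. \<bar>a + \<tau> - of_int n\<bar> < \<epsilon>} \<le> ennreal (6 * \<epsilon>)"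
proof -
  let ?I = "\<lambda>i::nat. {of_int \<lfloor>a\<rfloor> + real i - a - \<epsilon>..of_int \<lfloor>a\<rfloor> + real i - a + \<epsilon>}"
  have "{\<tau> \<in> {0..1}. \<exists>n::int. \<bar>a + \<tau> - of_int n\<bar> < \<epsilon>} \<subseteq> (\<Union>i\<in>{..<3}. ?I i)"
  proof
    fix \<tau> assume "\<tau> \<in> {\<tau> \<in> {0..1}. \<exists>n::int. \<bar>a + \<tau> - of_int n\<bar> < \<epsilon>}"
    then obtain n :: int where n: "0 \<le> \<tau>" "\<tau> \<le> 1" "\<bar>a + \<tau> - of_int n\<bar> < \<epsilon>" by auto
    have "of_int \<lfloor>a\<rfloor> - 1 < (of_int n :: real)" "(of_int n :: real) < of_int \<lfloor>a\<rfloor> + 3"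
      using n assms floor_correct[of a] by linarith+
    then have "\<lfloor>a\<rfloor> - 1 < n" "n < \<lfloor>a\<rfloor> + 3" by linarith+
    then have "nat (n - \<lfloor>a\<rfloor>) < 3" "of_int n = of_int \<lfloor>a\<rfloor> + real (nat (n - \<lfloor>a\<rfloor>))" by linarith+
    moreover from this(2) have "\<tau> \<in> ?I (nat (n - \<lfloor>a\<rfloor>))"
      unfolding atLeastAtMost_iff using n(3) by (intro conjI; linarith)
    ultimately show "\<tau> \<in> (\<Union>i\<in>{..<3}. ?I i)" by blast
  qed
  then have "emeasure lborel {\<tau> \<in> {0..1}. \<exists>n::int. \<bar>a + \<tau> - of_int n\<bar> < \<epsilon>} \<le> emeasure lborel (\<Union>i\<in>{..<3}. ?I i)"
    by (intro emeasure_mono) auto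
  also have "\<dots> \<le> (\<Sum>i\<in>{..<3}. emeasure lborel (?I i))"
    by (intro emeasure_subadditive_finite) auto
  also have "\<dots> = (\<Sum>i\<in>{..<3::nat}. ennreal (2 * \<epsilon>))"
    using assms by (intro sum.cong) auto
  also have "\<dots> = ennreal (6 * \<epsilon>)"
  proof -
    have "ennreal (6 * \<epsilon>) = ennreal 3 * ennreal (2 * \<epsilon>)"
      using assms by (subst ennreal_mult[symmetric]) auto
    then show ?thesis by simp
  qed
  finally show ?thesis .
qed

lemma norm_orthogonal_residual_le:
  fixes z \<theta> :: "'a::real_inner"
  assumes "norm \<theta> = 1"
  shows "norm (z - (z \<bullet> \<theta>) *\<^sub>R \<theta>) \<le> norm (z - c *\<^sub>R \<theta>)"
proof -
  have tt: "\<theta> \<bullet> \<theta> = 1" using assms by (simp add: norm_eq_1)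
  have "(z - c *\<^sub>R \<theta>) \<bullet> (z - c *\<^sub>R \<theta>) = (z - (z \<bullet> \<theta>) *\<^sub>R \<theta>) \<bullet> (z - (z \<bullet> \<theta>) *\<^sub>R \<theta>) + (z \<bullet> \<theta> - c)\<^sup>2"
    by (simp add: inner_diff_left inner_diff_right tt inner_commute power2_eq_square algebra_simps)
  then show ?thesis by (simp add: norm_le)
qed

text \<open>Half the sum in \<open>zonotope\<close> is the support function at \<open>u\<close> of
  the sum of the segments from - v/2 to v/2, and \<open>norm u\<close> is that of the unit ball. The
  bound \<epsilon> \<le> 1/2 serves to tell neighbouring integer phases apart.\<close>

locale direction_system =
  fixes V :: "'a::euclidean_space set" and \<epsilon> :: real
  assumes finite_V: "finite V" and zero_notin_V: "0 \<notin> V"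
    and nonparallel: "\<And>v w. v \<in> V \<Longrightarrow> w \<in> V \<Longrightarrow> v \<noteq> w \<Longrightarrow> w \<notin> span {v}"
    and zonotope: "\<And>u. (\<Sum>v\<in>V. \<bar>v \<bullet> u\<bar>) \<le> 2 * norm u"
    and eps: "0 < \<epsilon>" "\<epsilon> \<le> 1/2"
begin

text \<open>The zero set of \<open>cos (\<pi> (x \<bullet> v))\<close> consists of the points whose phase is an integer.\<close>

definition phase :: "'a \<Rightarrow> 'a \<Rightarrow> real" where
  "phase v x = x \<bullet> v - 1/2"

text \<open>The hyperplanes of the family of \<open>v\<close>, cut away from those of the other families: this
  separates the pieces from each other.\<close>

definition sheet :: "'a \<Rightarrow> 'a set" where
  "sheet v = {x. phase v x \<in> \<int> \<and> (\<forall>w\<in>V - {v}. \<forall>n::int. \<epsilon> \<le> \<bar>phase w x - of_int n\<bar>)}"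

definition sheets :: "'a set" where
  "sheets = (\<Union>v\<in>V. sheet v)"

text \<open>Adding t v to a point changes its phase by t (v \<bullet> v), so this moves along
  \<open>v\<close> to the nearest hyperplane of the family.\<close>

definition proj :: "'a \<Rightarrow> 'a \<Rightarrow> 'a" where
  "proj v x = x - ((phase v x - of_int (round (phase v x))) / (v \<bullet> v)) *\<^sub>R v"

text \<open>Points whose projection to the family of \<open>v\<close> is lost in the cut around the
  hyperplanes of \<open>w\<close>.\<close>

definition bad :: "'a \<Rightarrow> 'a \<Rightarrow> 'a set" where
  "bad v w = {x. \<exists>n::int. \<bar>phase w (proj v x) - of_int n\<bar> < \<epsilon>}"

text \<open>A hyperplane piece is weighed by the Lebesgue measure of the slab that projects to it;
  the factor \<open>norm v\<close> is the inverse of the thickness of the slab.\<close>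

definition mass :: "'a set \<Rightarrow> ennreal" where
  "mass E = (\<Sum>v\<in>V. ennreal (norm v) * emeasure lborel {x. proj v x \<in> E \<inter> sheet v})"

lemma V_nonzero: "v \<in> V \<Longrightarrow> v \<noteq> 0"
  using zero_notin_V by auto

text \<open>The zonotope bound at u = v already controls the single term of \<open>v\<close>. It
  makes all phases Lipschitz with constant 2, whatever the directions.\<close>

lemma norm_V_le: "v \<in> V \<Longrightarrow> norm v \<le> 2"
proof -
  assume v: "v \<in> V"
  have "\<bar>v \<bullet> v\<bar> \<le> (\<Sum>w\<in>V. \<bar>w \<bullet> v\<bar>)"
    using finite_V v by (intro member_le_sum[of v V "\<lambda>w. \<bar>w \<bullet> v\<bar>"]) auto
  also have "\<dots> \<le> 2 * norm v" by (rule zonotope)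
  finally have "norm v * norm v \<le> 2 * norm v" by (simp add: power2_norm_eq_inner[symmetric] power2_eq_square)
  then show ?thesis using V_nonzero[OF v] by simp
qed

lemma phase_diff_le: "v \<in> V \<Longrightarrow> \<bar>phase v x - phase v y\<bar> \<le> 2 * dist x y"
proof -
  assume v: "v \<in> V"
  have "\<bar>(x - y) \<bullet> v\<bar> \<le> norm (x - y) * norm v" by (rule Cauchy_Schwarz_ineq2)
  also have "\<dots> \<le> norm (x - y) * 2" using norm_V_le[OF v] by (intro mult_left_mono) auto
  finally show ?thesis by (simp add: phase_def inner_diff_left dist_norm)
qed

text \<open>At distance below \<epsilon>/2, phases differ by less than \<epsilon>. On a sheet of
  \<open>w\<close> the phase of \<open>w\<close> is an integer, while on a sheet of another vector
  it stays \<epsilon> away from the integers; within one family, distinct integers are at least 1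
  apart.\<close>

lemma sheet_separation:
  assumes "v \<in> V" "w \<in> V" "x \<in> sheet v" "y \<in> sheet w" "dist x y < \<epsilon> / 2"
  shows "w = v" "phase v y = phase v x"
proof -
  show "w = v"
  proof (rule ccontr)
    assume "w \<noteq> v"
    obtain n where "phase w y = of_int n" using assms(4) by (auto simp: sheet_def elim: Ints_cases)
    moreover have "\<epsilon> \<le> \<bar>phase w x - of_int n\<bar>"
      using assms(2,3) \<open>w \<noteq> v\<close> by (auto simp: sheet_def)
    ultimately show False using phase_diff_le[OF assms(2), of x y] assms(5) by simp
  qed
  with assms(3,4) obtain m n where "phase v x = of_int m" "phase v y = of_int n"
    by (auto simp: sheet_def elim!: Ints_cases)
  moreover have "\<bar>phase v x - phase v y\<bar> < 1"
    using phase_diff_le[OF assms(1), of x y] assms(5) eps by linarith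
  ultimately have "\<bar>real_of_int (m - n)\<bar> < 1" by simp
  then have "m = n" by linarith
  with \<open>phase v x = of_int m\<close> \<open>phase v y = of_int n\<close> show "phase v y = phase v x" by simp
qed

lemma continuous_phase [continuous_intros]: "continuous_on A (phase v)"
  unfolding phase_def by (intro continuous_intros)

lemma borel_measurable_phase [measurable]: "phase v \<in> borel_measurable borel"
  by (intro borel_measurable_continuous_onI continuous_intros)

lemma borel_measurable_proj [measurable]: "proj v \<in> borel_measurable borel"
  unfolding proj_def round_def by measurable

lemma closed_sheet: "closed (sheet v)"
proof -
  have "sheet v = phase v -` \<int> \<inter> (\<Inter>w\<in>V - {v}. \<Inter>n::int. {x. \<epsilon> \<le> \<bar>phase w x - of_int n\<bar>})"
    by (auto simp: sheet_def)
  moreover have "closed (phase v -` \<int>)"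
    by (intro continuous_closed_vimage closed_Ints) (metis continuous_phase continuous_on_eq_continuous_at open_UNIV UNIV_I)
  ultimately show ?thesis
    by (auto intro!: closed_Int closed_INT closed_Collect_le continuous_intros)
qed

lemma closed_sheets: "closed sheets"
  unfolding sheets_def using finite_V closed_sheet by (intro closed_UN) auto

lemma sets_sheet [measurable]: "sheet v \<in> sets borel"
  using closed_sheet by (rule borel_closed)

lemma sets_bad [measurable]: "bad v w \<in> sets borel"
  unfolding bad_def by measurable

lemma phase_proj: "v \<in> V \<Longrightarrow> phase v (proj v x) = of_int (round (phase v x))"
  using V_nonzero[of v] by (simp add: phase_def proj_def inner_diff_left)

lemma dist_proj_le: "v \<in> V \<Longrightarrow> dist (proj v x) x \<le> 1 / (2 * norm v)"
proof -
  assume "v \<in> V"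
  then have "0 < norm v" using V_nonzero by auto
  have "dist (proj v x) x = \<bar>phase v x - of_int (round (phase v x))\<bar> / (norm v * norm v) * norm v"
    by (simp add: proj_def dist_norm dot_square_norm power2_eq_square)
  also have "\<dots> = \<bar>phase v x - of_int (round (phase v x))\<bar> / norm v"
    using \<open>0 < norm v\<close> by simp
  also have "\<dots> \<le> (1/2) / norm v"
    using of_int_round_abs_le[of "phase v x"] by (intro divide_right_mono) (auto simp: abs_minus_commute)
  finally show ?thesis by simp
qed

section \<open>Regularity of the sheets\<close>

lemma hausdorff_sheets_small_cball:
  assumes dim: "DIM('b::euclidean_space) + 1 = DIM('a)" and "0 < r" "r < \<epsilon> / 4"
  shows "hausdorff_meas DIM('b) (sheets \<inter> cball x r) \<le> ennreal (unit_ball_vol (real DIM('b)) * r ^ DIM('b))"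
proof (cases "sheets \<inter> cball x r = {}")
  case False
  then obtain z v where z: "v \<in> V" "z \<in> sheet v" "dist x z \<le> r" by (auto simp: sheets_def)
  \<comment> \<open>The diameter of the ball is below \<epsilon>/2, so it meets a single
    hyperplane.\<close>
  have "sheets \<inter> cball x r \<subseteq> {y. y \<bullet> v = phase v z + 1/2} \<inter> cball x r"
  proof (intro subsetI IntI CollectI)
    fix y assume y: "y \<in> sheets \<inter> cball x r"
    then obtain w where w: "w \<in> V" "y \<in> sheet w" by (auto simp: sheets_def)
    have "dist z y < \<epsilon> / 2"
      using y z(3) assms(3) dist_triangle3[of z y x] by simp
    from sheet_separation(2)[OF z(1) w(1) z(2) w(2) this]
    show "y \<bullet> v = phase v z + 1/2" by (simp add: phase_def)
  qed auto
  then show ?thesis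
    using hausdorff_meas_mono hausdorff_meas_hyperplane_cball[OF V_nonzero[OF z(1)] dim, of r] assms(2)
    by (meson less_imp_le order_trans)
qed simp

lemma regular_sheets:
  assumes dim: "DIM('b::euclidean_space) + 1 = DIM('a)"
  shows "\<exists>\<phi>. \<phi> \<in> {0..<1} \<rightarrow> {0..} \<and> continuous (at 0 within {0..<1}) \<phi> \<and> \<phi> 0 = 1 \<and> regular_set \<phi> sheets"
proof -
  have k: "DIM('a) - 1 = DIM('b)" using dim by simp
  obtain K where K: "finite K" "cball (0::'a) 1 \<subseteq> (\<Union>c\<in>K. ball c (\<epsilon> / 5))"
  proof (rule compactE_image[of "cball (0::'a) 1" "cball 0 1" "\<lambda>c. ball c (\<epsilon> / 5)"])
    show "cball (0::'a) 1 \<subseteq> (\<Union>c\<in>cball 0 1. ball c (\<epsilon> / 5))" using eps(1) by force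
  qed auto
  \<comment> \<open>Constant near 0, which makes continuity there trivial. For r \<ge> \<epsilon>/4
    the crude factor counts balls of radius \<epsilon>/5, below the threshold \<epsilon>/4, that
    cover a unit ball.\<close>
  define \<phi> where "\<phi> r = (if r < \<epsilon> / 4 then 1 else real (card K))" for r :: real
  have "hausdorff_meas DIM('b) (sheets \<inter> cball x r) \<le> ennreal (\<phi> r * unit_ball_vol (real DIM('b)) * r ^ DIM('b))"
    if r: "0 < r" "r < 1" for x r
  proof (cases "r < \<epsilon> / 4")
    case True
    then show ?thesis using hausdorff_sheets_small_cball[OF dim, of r x] r by (simp add: \<phi>_def)
  next
    case False
    let ?b = "ennreal (unit_ball_vol (real DIM('b)) * r ^ DIM('b))"
    have "sheets \<inter> cball x r \<subseteq> (\<Union>c\<in>K. sheets \<inter> cball (x + c) (\<epsilon> / 5))"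
    proof
      fix y assume y: "y \<in> sheets \<inter> cball x r"
      then have "y - x \<in> cball 0 1" using r by (simp add: dist_norm norm_minus_commute)
      then obtain c where "c \<in> K" "y - x \<in> ball c (\<epsilon> / 5)" using K(2) by blast
      then show "y \<in> (\<Union>c\<in>K. sheets \<inter> cball (x + c) (\<epsilon> / 5))"
        using y by (intro UN_I[of c]) (auto simp: dist_norm algebra_simps)
    qed
    then have "hausdorff_meas DIM('b) (sheets \<inter> cball x r) \<le> hausdorff_meas DIM('b) (\<Union>c\<in>K. sheets \<inter> cball (x + c) (\<epsilon> / 5))"
      by (rule hausdorff_meas_mono)
    also have "\<dots> \<le> of_nat (card K) * ?b"
    proof (rule hausdorff_meas_UN_le_card[OF K(1)])
      fix c
      have "hausdorff_meas DIM('b) (sheets \<inter> cball (x + c) (\<epsilon> / 5)) \<le> ennreal (unit_ball_vol (real DIM('b)) * (\<epsilon> / 5) ^ DIM('b))"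
        using eps(1) by (intro hausdorff_sheets_small_cball[OF dim]) auto
      also have "\<dots> \<le> ?b"
        using False eps(1) by (intro ennreal_leI mult_left_mono power_mono) auto
      finally show "hausdorff_meas DIM('b) (sheets \<inter> cball (x + c) (\<epsilon> / 5)) \<le> ?b" .
    qed
    also have "\<dots> = ennreal (\<phi> r * unit_ball_vol (real DIM('b)) * r ^ DIM('b))"
      using False r by (simp add: \<phi>_def ennreal_of_nat_eq_real_of_nat ennreal_mult'[symmetric] mult.assoc)
    finally show ?thesis .
  qed
  then have "regular_set \<phi> sheets"
    unfolding regular_set_def regular_meas_def k using closed_sheets by auto
  moreover have "continuous (at 0 within {0..<1}) \<phi>"
  proof -
    have "\<forall>\<^sub>F r in at 0 within {0..<1}. \<phi> r = \<phi> 0"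
      unfolding eventually_at using eps(1) by (intro exI[of _ "\<epsilon> / 4"]) (auto simp: \<phi>_def)
    then show ?thesis unfolding continuous_within by (rule tendsto_eventually)
  qed
  ultimately show ?thesis using eps(1) by (intro exI[of _ \<phi>]) (auto simp: \<phi>_def)
qed

section \<open>Surface density of the sheets\<close>

lemma mass_subadditive:
  assumes "\<And>j::nat. closed (B j)" "E \<subseteq> (\<Union>j. B j)"
  shows "mass E \<le> (\<Sum>j. mass (B j))"
proof -
  have [measurable]: "B j \<in> sets borel" for j using assms(1) by (rule borel_closed)
  have "mass E \<le> (\<Sum>v\<in>V. ennreal (norm v) * (\<Sum>j. emeasure lborel {x. proj v x \<in> B j \<inter> sheet v}))"
    unfolding mass_def
  proof (intro sum_mono mult_left_mono)
    fix v
    \<comment> \<open>\<open>E\<close> is arbitrary: should the set on the left not be measurable,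
      its \<open>emeasure\<close> is 0 and monotonicity still holds.\<close>
    have "emeasure lborel {x. proj v x \<in> E \<inter> sheet v} \<le> emeasure lborel (\<Union>j. {x. proj v x \<in> B j \<inter> sheet v})"
      using assms(2) by (intro emeasure_mono) auto
    also have "\<dots> \<le> (\<Sum>j. emeasure lborel {x. proj v x \<in> B j \<inter> sheet v})"
      by (intro emeasure_subadditive_countably) auto
    finally show "emeasure lborel {x. proj v x \<in> E \<inter> sheet v} \<le> (\<Sum>j. emeasure lborel {x. proj v x \<in> B j \<inter> sheet v})" .
  qed auto
  also have "\<dots> = (\<Sum>j. mass (B j))"
    unfolding mass_def ennreal_suminf_cmult[symmetric] by (rule suminf_sum[symmetric]) (rule summableI)
  finally show ?thesis .
qed

text \<open>Inside the ball the sheets lie in one hyperplane, and the points projecting there lie in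
  a cylinder of radius \<open>s\<close> and height 1 / \<open>norm v\<close>; the weight
  \<open>norm v\<close> cancels the height.\<close>

lemma mass_cball_le:
  assumes dim: "DIM('b::euclidean_space) + 1 = DIM('a)" and "0 < s" "s \<le> \<epsilon> / 5"
  shows "mass (cball y s) \<le> ennreal (unit_ball_vol (real DIM('b)) * s ^ DIM('b))"
proof (cases "sheets \<inter> cball y s = {}")
  case True
  then have "{x. proj v x \<in> cball y s \<inter> sheet v} = {}" if "v \<in> V" for v
    using that by (auto simp: sheets_def)
  then have "mass (cball y s) = 0" unfolding mass_def by (intro sum.neutral ballI) (simp only: emeasure_empty mult_zero_right)
  then show ?thesis by simp
next
  case False
  then obtain z v where z: "v \<in> V" "z \<in> sheet v" "dist y z \<le> s" by (auto simp: sheets_def)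
  have near: "w = v \<and> phase v p = phase v z" if "w \<in> V" "p \<in> cball y s \<inter> sheet w" for w p
  proof -
    have "dist z p < \<epsilon> / 2"
      using that z(3) assms(3) eps(1) dist_triangle3[of z p y] by simp
    then show ?thesis using sheet_separation[OF z(1) that(1) z(2)] that by blast
  qed
  have "{x. proj w x \<in> cball y s \<inter> sheet w} = {}" if "w \<in> V - {v}" for w
    using near[of w] that by blast
  then have "mass (cball y s) = (\<Sum>w\<in>{v}. ennreal (norm w) * emeasure lborel {x. proj w x \<in> cball y s \<inter> sheet w})"
    unfolding mass_def using finite_V z(1)
    by (intro sum.mono_neutral_right ballI) (simp_all only: emeasure_empty mult_zero_right, auto)
  then have m: "mass (cball y s) = ennreal (norm v) * emeasure lborel {x. proj v x \<in> cball y s \<inter> sheet v}" by simp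
  define \<theta> where "\<theta> = v /\<^sub>R norm v"
  have v: "0 < norm v" using V_nonzero[OF z(1)] by simp
  have th: "norm \<theta> = 1" using v by (simp add: \<theta>_def)
  define N where "N = phase v z"
  let ?C = "{x. x \<bullet> \<theta> \<in> {N / norm v..(N + 1) / norm v} \<and> norm ((x - y) - ((x - y) \<bullet> \<theta>) *\<^sub>R \<theta>) \<le> s}"
  have "{x. proj v x \<in> cball y s \<inter> sheet v} \<subseteq> ?C"
  proof (intro subsetI CollectI conjI)
    fix x assume x: "x \<in> {x. proj v x \<in> cball y s \<inter> sheet v}"
    then have "phase v (proj v x) = N" using near[OF z(1)] by (auto simp: N_def)
    then have "of_int (round (phase v x)) = N" using phase_proj[OF z(1)] by simp
    then have "\<bar>phase v x - N\<bar> \<le> 1/2"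
      using of_int_round_abs_le[of "phase v x"] by (simp add: abs_minus_commute)
    \<comment> \<open>The offset 1/2 in \<open>phase\<close> turns the rounding interval about N
      into [N, N + 1] for x \<bullet> v.\<close>
    then have "N \<le> x \<bullet> v" "x \<bullet> v \<le> N + 1" unfolding phase_def by linarith+
    then show "x \<bullet> \<theta> \<in> {N / norm v..(N + 1) / norm v}"
      using v by (simp add: \<theta>_def divide_inverse_commute mult_left_mono)
    define c where "c = (phase v x - of_int (round (phase v x))) / norm v"
    have "proj v x = x - c *\<^sub>R \<theta>"
      using v by (simp add: proj_def c_def \<theta>_def dot_square_norm power2_eq_square divide_inverse mult.assoc)
    \<comment> \<open>The component of x - y orthogonal to \<theta> is the shortest among all x - y
      - c \<theta>, so the size of the shift \<open>c\<close> does not matter.\<close>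
    then have "proj v x - y = (x - y) - c *\<^sub>R \<theta>" by simp
    moreover have "norm (proj v x - y) \<le> s" using x by (simp add: dist_norm norm_minus_commute)
    ultimately show "norm ((x - y) - ((x - y) \<bullet> \<theta>) *\<^sub>R \<theta>) \<le> s"
      using order_trans[OF norm_orthogonal_residual_le[OF th, of "x - y" c]] by (simp only:)
  qed
  then have "emeasure lborel {x. proj v x \<in> cball y s \<inter> sheet v} \<le> emeasure lborel ?C"
    by (intro emeasure_mono) (auto, measurable)
  also have "\<dots> = ennreal (((N + 1) / norm v - N / norm v) * (unit_ball_vol (real DIM('b)) * s ^ DIM('b)))"
    using v assms(2) by (intro emeasure_lborel_cylinder[OF th dim]) (auto simp: divide_right_mono)
  also have "(N + 1) / norm v - N / norm v = 1 / norm v" by (simp add: diff_divide_distrib[symmetric])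
  finally have "mass (cball y s) \<le> ennreal (norm v) * ennreal (1 / norm v * (unit_ball_vol (real DIM('b)) * s ^ DIM('b)))"
    unfolding m by (rule mult_left_mono) simp
  also have "\<dots> = ennreal (unit_ball_vol (real DIM('b)) * s ^ DIM('b))"
    using v assms(2) by (simp add: ennreal_mult'[symmetric])
  finally show ?thesis .
qed

text \<open>Bounds the Hausdorff measure from below by volumes of slabs, for which averaging over
  translations is available.\<close>

lemma mass_le_hausdorff:
  assumes dim: "DIM('b::euclidean_space) + 1 = DIM('a)"
  shows "mass E \<le> hausdorff_meas DIM('b) E"
proof (rule hausdorff_meas_mass_distribution)
  show "0 < \<epsilon> / 5" using eps by simp
  show "mass {} = 0" by (simp add: mass_def)
qed (use mass_subadditive mass_cball_le[OF dim] in auto)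

text \<open>Translation along a vector \<open>u\<close> with \<open>u \<bullet> v = 0\<close> and \<open>u \<bullet> w = 1\<close> preserves the slabs of \<open>v\<close> and
  shifts the phase of \<open>w\<close> at unit speed; average over such translations.\<close>

lemma emeasure_bad_le:
  assumes "v \<in> V" "w \<in> V" "v \<noteq> w"
  shows "\<exists>W\<ge>0. \<forall>x r. 0 \<le> r \<longrightarrow>
    emeasure lborel (bad v w \<inter> cball x r) \<le> ennreal (6 * \<epsilon> * (unit_ball_vol (real DIM('a)) * (r + W) ^ DIM('a)))"
proof -
  let ?\<omega> = "unit_ball_vol (real DIM('a))"
  \<comment> \<open>The component of \<open>w\<close> orthogonal to \<open>v\<close>, nonzero
    because the two are not parallel; divided by z \<bullet> z it moves the phase of
    \<open>w\<close> at unit speed.\<close>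
  define z where "z = w - ((w \<bullet> v) / (v \<bullet> v)) *\<^sub>R v"
  have zv: "z \<bullet> v = 0" using V_nonzero[OF assms(1)] by (simp add: z_def inner_diff_left)
  have "z \<noteq> 0"
  proof
    assume "z = 0"
    then have "w = ((w \<bullet> v) / (v \<bullet> v)) *\<^sub>R v" by (simp add: z_def)
    then have "w \<in> span {v}" by (metis span_base span_scale singletonI)
    then show False using nonparallel[OF assms] by blast
  qed
  have zw: "z \<bullet> w = z \<bullet> z"
  proof -
    have "z \<bullet> z = z \<bullet> w - ((w \<bullet> v) / (v \<bullet> v)) * (z \<bullet> v)"
      by (subst (2) z_def) (simp only: inner_diff_right inner_scaleR_right)
    then show ?thesis by (simp add: zv)
  qed
  define u where "u = z /\<^sub>R (z \<bullet> z)"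
  have uv: "u \<bullet> v = 0" and uw: "u \<bullet> w = 1"
    using zv zw \<open>z \<noteq> 0\<close> by (simp_all add: u_def)
  have phase_v: "phase v (y + \<tau> *\<^sub>R u) = phase v y" for y \<tau>
    by (simp add: phase_def inner_add_left uv)
  have phase_w: "phase w (y + \<tau> *\<^sub>R u) = phase w y + \<tau>" for y \<tau>
    by (simp add: phase_def inner_add_left uw)
  have proj_shift: "proj v (y + \<tau> *\<^sub>R u) = proj v y + \<tau> *\<^sub>R u" for y \<tau>
    unfolding proj_def phase_v by simp
  have bad_shift: "y + \<tau> *\<^sub>R u \<in> bad v w \<longleftrightarrow> (\<exists>n::int. \<bar>phase w (proj v y) + \<tau> - of_int n\<bar> < \<epsilon>)" for y \<tau>
    unfolding bad_def mem_Collect_eq proj_shift phase_w ..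
  have "emeasure lborel (bad v w \<inter> cball x r) \<le> ennreal (6 * \<epsilon> * (?\<omega> * (r + norm u) ^ DIM('a)))"
    if "0 \<le> r" for x r
  proof -
    \<comment> \<open>A translation by \<tau> u with \<tau> in [0, 1] displaces points by at most
      \<open>norm u\<close>, hence the larger ball.\<close>
    let ?S = "bad v w \<inter> cball x r" let ?C = "cball x (r + norm u)"
    have [measurable]: "?C \<in> sets borel" "?S \<in> sets borel" by auto
    have shift: "emeasure lborel ?S \<le> (\<integral>\<^sup>+y. indicator ?C y * indicator (bad v w) (y + \<tau> *\<^sub>R u) \<partial>lborel)"
      if "\<tau> \<in> {0..1}" for \<tau>
    proof -
      have "emeasure lborel ?S = emeasure (distr lborel borel ((+) (\<tau> *\<^sub>R u))) ?S"
        by (simp add: lborel_distr_plus)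
      also have "\<dots> = (\<integral>\<^sup>+y. indicator ?S (\<tau> *\<^sub>R u + y) \<partial>lborel)"
        by (subst nn_integral_indicator[symmetric], simp, subst nn_integral_distr) auto
      also have "\<dots> \<le> (\<integral>\<^sup>+y. indicator ?C y * indicator (bad v w) (y + \<tau> *\<^sub>R u) \<partial>lborel)"
      proof (intro nn_integral_mono)
        fix y
        have "y \<in> ?C" if "\<tau> *\<^sub>R u + y \<in> cball x r"
        proof -
          have "dist x y \<le> dist x (\<tau> *\<^sub>R u + y) + dist (\<tau> *\<^sub>R u + y) y" by (rule dist_triangle)
          also have "dist (\<tau> *\<^sub>R u + y) y \<le> norm u"
            using \<open>\<tau> \<in> {0..1}\<close> by (simp add: dist_norm mult_left_le_one_le)
          finally show ?thesis using that by simp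
        qed
        then show "indicator ?S (\<tau> *\<^sub>R u + y) \<le> (indicator ?C y * indicator (bad v w) (y + \<tau> *\<^sub>R u) :: ennreal)"
          by (auto simp: indicator_def add.commute)
      qed
      finally show ?thesis .
    qed
    have "emeasure lborel ?S = (\<integral>\<^sup>+\<tau>. emeasure lborel ?S * indicator {0..1::real} \<tau> \<partial>lborel)"
      by (subst nn_integral_cmult_indicator) auto
    also have "\<dots> \<le> (\<integral>\<^sup>+\<tau>. \<integral>\<^sup>+y. indicator {0..1} \<tau> * (indicator ?C y * indicator (bad v w) (y + \<tau> *\<^sub>R u)) \<partial>lborel \<partial>lborel)"
      using shift by (intro nn_integral_mono) (auto simp: indicator_def)
    also have "\<dots> = (\<integral>\<^sup>+y. \<integral>\<^sup>+\<tau>. indicator {0..1} \<tau> * (indicator ?C y * indicator (bad v w) (y + \<tau> *\<^sub>R u)) \<partial>lborel \<partial>lborel)"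
      by (rule lborel_pair.Fubini') measurable
    \<comment> \<open>For fixed y, \<tau> runs over a full period of the phase of \<open>w\<close>,
      and the bad \<tau> have measure at most 6 \<epsilon>.\<close>
    also have "\<dots> \<le> (\<integral>\<^sup>+y. ennreal (6 * \<epsilon>) * indicator ?C y \<partial>lborel)"
    proof (intro nn_integral_mono)
      fix y
      let ?T = "{\<tau> \<in> {0..1}. \<exists>n::int. \<bar>phase w (proj v y) + \<tau> - of_int n\<bar> < \<epsilon>}"
      have "(\<integral>\<^sup>+\<tau>. indicator {0..1} \<tau> * (indicator ?C y * indicator (bad v w) (y + \<tau> *\<^sub>R u)) \<partial>lborel)
          = (\<integral>\<^sup>+\<tau>. indicator ?C y * indicator ?T \<tau> \<partial>lborel)"
        by (intro nn_integral_cong) (auto simp: indicator_def bad_shift)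
      also have "\<dots> = indicator ?C y * emeasure lborel ?T"
        by (intro nn_integral_cmult_indicator) measurable
      also have "\<dots> \<le> indicator ?C y * ennreal (6 * \<epsilon>)"
        using emeasure_near_integers_le[OF eps] by (intro mult_left_mono) auto
      finally show "(\<integral>\<^sup>+\<tau>. indicator {0..1} \<tau> * (indicator ?C y * indicator (bad v w) (y + \<tau> *\<^sub>R u)) \<partial>lborel)
          \<le> ennreal (6 * \<epsilon>) * indicator ?C y" by (simp add: mult.commute)
    qed
    also have "\<dots> = ennreal (6 * \<epsilon>) * emeasure lborel ?C"
      by (rule nn_integral_cmult_indicator) simp
    also have "\<dots> = ennreal (6 * \<epsilon> * (?\<omega> * (r + norm u) ^ DIM('a)))"
      using that eps by (simp add: emeasure_cball ennreal_mult'[symmetric])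
    finally show ?thesis .
  qed
  then show ?thesis by (intro exI[of _ "norm u"]) auto
qed

text \<open>Points within r - p of \<open>x\<close> project into the ball of radius
  \<open>r\<close>, and onto a sheet unless they are bad. So each family contributes at least a full
  ball minus the bad sets. That \<open>p\<close> and \<open>W\<close> are independent of
  \<open>x\<close> and \<open>r\<close> makes the bound uniform.\<close>

lemma mass_sheets_cball_ge:
  "\<exists>p W. \<forall>x r. 0 \<le> r \<and> p \<le> r \<longrightarrow>
    ennreal ((\<Sum>v\<in>V. norm v) * (unit_ball_vol (real DIM('a)) *
      ((r - p) ^ DIM('a) - 6 * \<epsilon> * real (card V) * (r + W) ^ DIM('a)))) \<le> mass (sheets \<inter> cball x r)"
proof -
  let ?\<omega> = "unit_ball_vol (real DIM('a))" let ?d = "DIM('a)"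
  \<comment> \<open>A sum in place of a maximum: it bounds every displacement 1 / (2 norm
    v).\<close>
  define p where "p = (\<Sum>v\<in>V. 1 / (2 * norm v))"
  have "\<exists>W. \<forall>q. fst q \<in> V \<and> snd q \<in> V \<and> fst q \<noteq> snd q \<longrightarrow> 0 \<le> W q \<and> (\<forall>x r. 0 \<le> r \<longrightarrow>
      emeasure lborel (bad (fst q) (snd q) \<inter> cball x r) \<le> ennreal (6 * \<epsilon> * (?\<omega> * (r + W q) ^ ?d)))"
    using emeasure_bad_le by (intro choice) blast
  then obtain W0 where W0: "\<And>v w. v \<in> V \<Longrightarrow> w \<in> V \<Longrightarrow> v \<noteq> w \<Longrightarrow> 0 \<le> W0 (v, w)"
    "\<And>v w x r. v \<in> V \<Longrightarrow> w \<in> V \<Longrightarrow> v \<noteq> w \<Longrightarrow> 0 \<le> r \<Longrightarrow>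
      emeasure lborel (bad v w \<inter> cball x r) \<le> ennreal (6 * \<epsilon> * (?\<omega> * (r + W0 (v, w)) ^ ?d))"
    by (metis fst_conv snd_conv)
  define W where "W = (\<Sum>q\<in>V \<times> V. \<bar>W0 q\<bar>)"
  have bad_le: "emeasure lborel (bad v w \<inter> cball x r) \<le> ennreal (6 * \<epsilon> * (?\<omega> * (r + W) ^ ?d))"
    if "v \<in> V" "w \<in> V" "v \<noteq> w" "0 \<le> r" for v w x r
  proof -
    have "\<bar>W0 (v, w)\<bar> \<le> W"
      unfolding W_def using finite_V that by (intro member_le_sum[of "(v, w)" "V \<times> V" "\<lambda>q. \<bar>W0 q\<bar>"]) auto
    then have "6 * \<epsilon> * (?\<omega> * (r + W0 (v, w)) ^ ?d) \<le> 6 * \<epsilon> * (?\<omega> * (r + W) ^ ?d)"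
      using that eps W0(1)[OF that(1,2,3)] by (intro mult_left_mono power_mono) auto
    then show ?thesis using W0(2)[OF that, of x] by (meson ennreal_leI order_trans)
  qed
  have piece: "ennreal (?\<omega> * ((r - p) ^ ?d - 6 * \<epsilon> * real (card V) * (r + W) ^ ?d))
      \<le> emeasure lborel {y. proj v y \<in> (sheets \<inter> cball x r) \<inter> sheet v}" (is "_ \<le> ?X")
    if v: "v \<in> V" and r: "0 \<le> r" "p \<le> r" for v x r
  proof -
    have meas[measurable]: "{y. proj v y \<in> (sheets \<inter> cball x r) \<inter> sheet v} \<in> sets borel"
    proof -
      have "(sheets \<inter> cball x r) \<inter> sheet v \<in> sets borel"
        using closed_sheets closed_sheet by (intro borel_closed closed_Int) auto
      from measurable_sets[OF borel_measurable_proj this] show ?thesis by (simp add: vimage_def)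
    qed
    have "1 / (2 * norm v) \<le> p"
      unfolding p_def using finite_V v by (intro member_le_sum[of v V "\<lambda>v. 1 / (2 * norm v)"]) auto
    have "cball x (r - p) \<subseteq> {y. proj v y \<in> (sheets \<inter> cball x r) \<inter> sheet v} \<union> (\<Union>w\<in>V - {v}. bad v w \<inter> cball x r)"
    proof
      fix y assume y: "y \<in> cball x (r - p)"
      have "0 \<le> p" unfolding p_def by (intro sum_nonneg) auto
      then have "y \<in> cball x r" using y by simp
      have "dist x (proj v y) \<le> r"
        using y dist_triangle[of x "proj v y" y] dist_proj_le[OF v, of y] \<open>1 / (2 * norm v) \<le> p\<close>
        by (simp add: dist_commute)
      moreover have "phase v (proj v y) \<in> \<int>" using phase_proj[OF v] by simp
      moreover have "proj v y \<in> sheet v \<or> (\<exists>w\<in>V - {v}. y \<in> bad v w)"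
        using \<open>phase v (proj v y) \<in> \<int>\<close> by (simp add: sheet_def bad_def) (meson not_le)
      ultimately show "y \<in> {y. proj v y \<in> (sheets \<inter> cball x r) \<inter> sheet v} \<union> (\<Union>w\<in>V - {v}. bad v w \<inter> cball x r)"
        using v \<open>y \<in> cball x r\<close> unfolding sheets_def by (auto simp: dist_commute)
    qed
    moreover define Z where "Z = (\<Union>w\<in>V - {v}. bad v w \<inter> cball x r)"
    ultimately have sub: "cball x (r - p) \<subseteq> {y. proj v y \<in> (sheets \<inter> cball x r) \<inter> sheet v} \<union> Z" by simp
    have Zm: "Z \<in> sets lborel" unfolding Z_def using finite_V by (intro sets.finite_UN) auto
    have "emeasure lborel (cball x (r - p)) \<le> emeasure lborel ({y. proj v y \<in> (sheets \<inter> cball x r) \<inter> sheet v} \<union> Z)"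
      using sub meas Zm by (intro emeasure_mono sets.Un) (simp_all only: sets_lborel)
    also have "\<dots> \<le> ?X + emeasure lborel Z"
      using meas Zm by (intro emeasure_subadditive) (simp_all only: sets_lborel)
    finally have X: "emeasure lborel (cball x (r - p)) \<le> ?X + emeasure lborel Z" .
    have "emeasure lborel Z \<le> (\<Sum>w\<in>V - {v}. emeasure lborel (bad v w \<inter> cball x r))"
      unfolding Z_def using finite_V by (intro emeasure_subadditive_finite) auto
    also have "\<dots> \<le> (\<Sum>w\<in>V - {v}. ennreal (6 * \<epsilon> * (?\<omega> * (r + W) ^ ?d)))"
      using v r by (intro sum_mono bad_le) auto
    also have "\<dots> \<le> (\<Sum>w\<in>V. ennreal (6 * \<epsilon> * (?\<omega> * (r + W) ^ ?d)))"
      using finite_V by (intro sum_mono2) auto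
    also have "\<dots> = ennreal (real (card V)) * ennreal (6 * \<epsilon> * (?\<omega> * (r + W) ^ ?d))"
      by (simp add: ennreal_of_nat_eq_real_of_nat)
    also have "\<dots> = ennreal (real (card V) * (6 * \<epsilon> * (?\<omega> * (r + W) ^ ?d)))"
      by (rule ennreal_mult'[symmetric]) simp
    finally have Z: "emeasure lborel Z \<le> ennreal (real (card V) * (6 * \<epsilon> * (?\<omega> * (r + W) ^ ?d)))" .
    have le: "ennreal (?\<omega> * (r - p) ^ ?d) \<le> ?X + ennreal (real (card V) * (6 * \<epsilon> * (?\<omega> * (r + W) ^ ?d)))"
      using order_trans[OF X add_left_mono[OF Z]] emeasure_cball[of "r - p" x] r by simp
    have "0 \<le> W" unfolding W_def by (intro sum_nonneg) auto
    then have nn: "0 \<le> real (card V) * (6 * \<epsilon> * (?\<omega> * (r + W) ^ ?d))" using r eps by simp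
    \<comment> \<open>A negative difference is sent to 0 by \<open>ennreal\<close>, just as by
      truncated subtraction, so small \<open>r\<close> needs no separate treatment.\<close>
    have "ennreal (?\<omega> * (r - p) ^ ?d - real (card V) * (6 * \<epsilon> * (?\<omega> * (r + W) ^ ?d)))
        = ennreal (?\<omega> * (r - p) ^ ?d) - ennreal (real (card V) * (6 * \<epsilon> * (?\<omega> * (r + W) ^ ?d)))"
      by (rule ennreal_minus[OF nn, symmetric])
    also have "\<dots> \<le> ?X"
      using le by (simp add: ennreal_minus_le_iff add.commute)
    finally show ?thesis by (simp add: algebra_simps)
  qed
  have "ennreal ((\<Sum>v\<in>V. norm v) * (?\<omega> * ((r - p) ^ ?d - 6 * \<epsilon> * real (card V) * (r + W) ^ ?d))) \<le> mass (sheets \<inter> cball x r)"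
    if r: "0 \<le> r" "p \<le> r" for x r
  proof -
    let ?Y = "?\<omega> * ((r - p) ^ ?d - 6 * \<epsilon> * real (card V) * (r + W) ^ ?d)"
    have "ennreal ((\<Sum>v\<in>V. norm v) * ?Y) = ennreal (\<Sum>v\<in>V. norm v) * ennreal ?Y"
      by (rule ennreal_mult') (simp add: sum_nonneg)
    also have "\<dots> = (\<Sum>v\<in>V. ennreal (norm v) * ennreal ?Y)"
      by (simp add: sum_ennreal[symmetric] sum_distrib_right del: sum_ennreal)
    also have "\<dots> \<le> mass (sheets \<inter> cball x r)"
      unfolding mass_def using r by (intro sum_mono mult_left_mono piece) auto
    finally show ?thesis .
  qed
  then show ?thesis by blast
qed

text \<open>After division by the volume of the ball, \<open>p\<close> and \<open>W\<close> enter as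
  p/r and W/r and disappear in the limit; what remains is the relative loss 6 \<epsilon> card
  V.\<close>

lemma lower_surface_density_sheets:
  assumes dim: "DIM('b::euclidean_space) + 1 = DIM('a)"
    and c: "0 \<le> c" "c < (\<Sum>v\<in>V. norm v) * (1 - 6 * \<epsilon> * real (card V))"
  shows "ennreal c \<le> lower_surface_density sheets"
proof -
  let ?\<omega> = "unit_ball_vol (real DIM('a))" let ?d = "DIM('a)" let ?S = "\<Sum>v\<in>V. norm v"
  have k: "DIM('a) - 1 = DIM('b)" using dim by simp
  obtain p W where pW: "\<And>x r. 0 \<le> r \<Longrightarrow> p \<le> r \<Longrightarrow>
    ennreal (?S * (?\<omega> * ((r - p) ^ ?d - 6 * \<epsilon> * real (card V) * (r + W) ^ ?d))) \<le> mass (sheets \<inter> cball x r)"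
    using mass_sheets_cball_ge by blast
  have "((\<lambda>r. ?S * ((1 - p / r) ^ ?d - 6 * \<epsilon> * real (card V) * (1 + W / r) ^ ?d))
      \<longlongrightarrow> ?S * ((1 - 0) ^ ?d - 6 * \<epsilon> * real (card V) * (1 + 0) ^ ?d)) at_top"
    by (intro tendsto_intros real_tendsto_divide_at_top[OF tendsto_const filterlim_ident])
  then have ev: "\<forall>\<^sub>F r in at_top. c < ?S * ((1 - p / r) ^ ?d - 6 * \<epsilon> * real (card V) * (1 + W / r) ^ ?d)"
    using c(2) by (intro order_tendstoD) auto
  have ratio: "ennreal c = ennreal (c * q) / ennreal q" if "0 < q" for q
    using that c(1) by (subst divide_ennreal) auto
  show ?thesis
    unfolding lower_surface_density_def k
  proof (rule Liminf_bounded)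
    show "\<forall>\<^sub>F r in at_top. ennreal c \<le> (INF x. hausdorff_meas DIM('b) (sheets \<inter> cball x r) / emeasure lborel (cball x r))"
      using ev eventually_gt_at_top[of "max 0 p"]
    proof eventually_elim
      case (elim r)
      then have r: "0 < r" "p \<le> r" by auto
      have vol: "0 < ?\<omega> * r ^ ?d" using r by simp
      have "r ^ ?d * (1 - p / r) ^ ?d = (r - p) ^ ?d" "r ^ ?d * (1 + W / r) ^ ?d = (r + W) ^ ?d"
        using r by (simp_all add: power_mult_distrib[symmetric] right_diff_distrib distrib_left)
      then have e: "?\<omega> * r ^ ?d * (?S * ((1 - p / r) ^ ?d - 6 * \<epsilon> * real (card V) * (1 + W / r) ^ ?d))
          = ?S * (?\<omega> * ((r - p) ^ ?d - 6 * \<epsilon> * real (card V) * (r + W) ^ ?d))"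
        by (simp add: algebra_simps)
      have "c * (?\<omega> * r ^ ?d) = ?\<omega> * r ^ ?d * c" by simp
      also have "\<dots> \<le> ?\<omega> * r ^ ?d * (?S * ((1 - p / r) ^ ?d - 6 * \<epsilon> * real (card V) * (1 + W / r) ^ ?d))"
        using elim(1) vol by (intro mult_left_mono) auto
      also note e
      finally have le: "c * (?\<omega> * r ^ ?d) \<le> ?S * (?\<omega> * ((r - p) ^ ?d - 6 * \<epsilon> * real (card V) * (r + W) ^ ?d))" .
      show ?case
      proof (rule INF_greatest)
        fix x :: 'a
        have "ennreal c = ennreal (c * (?\<omega> * r ^ ?d)) / ennreal (?\<omega> * r ^ ?d)"
          by (rule ratio[OF vol])
        also have "\<dots> \<le> hausdorff_meas DIM('b) (sheets \<inter> cball x r) / ennreal (?\<omega> * r ^ ?d)"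
        proof (rule divide_right_mono_ennreal)
          have "ennreal (c * (?\<omega> * r ^ ?d)) \<le> mass (sheets \<inter> cball x r)"
            using order_trans[OF ennreal_leI[OF le] pW[of r x]] r by simp
          also have "\<dots> \<le> hausdorff_meas DIM('b) (sheets \<inter> cball x r)" by (rule mass_le_hausdorff[OF dim])
          finally show "ennreal (c * (?\<omega> * r ^ ?d)) \<le> hausdorff_meas DIM('b) (sheets \<inter> cball x r)" .
        qed
        finally show "ennreal c \<le> hausdorff_meas DIM('b) (sheets \<inter> cball x r) / emeasure lborel (cball x r)"
          using r by (simp add: emeasure_cball)
      qed
    qed
  qed
qed

section \<open>The product of cosines and its spectrum\<close>

definition trig :: "'a \<Rightarrow> complex" where
  "trig x = (\<Prod>v\<in>V. complex_of_real (cos (pi * (x \<bullet> v))))"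

lemma continuous_trig: "continuous_on UNIV trig"
  unfolding trig_def by (intro continuous_intros)

lemma trig_0: "trig 0 = 1"
  by (simp add: trig_def)

lemma norm_trig_le: "norm (trig x) \<le> 1"
  unfolding trig_def prod_norm[symmetric] by (intro prod_le_1) auto

lemma sheets_subset_zeros: "sheets \<subseteq> {x. trig x = 0}"
proof
  fix x assume "x \<in> sheets"
  then obtain v where v: "v \<in> V" "phase v x \<in> \<int>" by (auto simp: sheets_def sheet_def)
  then obtain n where "x \<bullet> v = of_int n + 1/2" by (auto simp: phase_def elim!: Ints_cases) (metis diff_add_cancel)
  then have "cos (pi * (x \<bullet> v)) = cos (of_int n * pi + pi / 2)" by (simp add: algebra_simps)
  also have "\<dots> = - sin (of_int n * pi)" by (simp add: cos_add)
  also have "\<dots> = 0" by (auto simp: sin_zero_iff_int2)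
  finally show "x \<in> {x. trig x = 0}" using v(1) finite_V by (auto simp: trig_def)
qed

text \<open>By continuity and \<open>trig_0\<close>, the modulus exceeds any c < 1 on an open set
  around 0, which has positive measure.\<close>

lemma Linf_norm_trig: "Linf_norm trig = 1"
proof (rule antisym)
  have meas[measurable]: "trig \<in> borel_measurable lborel"
    using borel_measurable_continuous_onI[OF continuous_trig] by simp
  show "Linf_norm trig \<le> 1"
    unfolding Linf_norm_def using norm_trig_le by (intro esssup_I) (auto simp: one_ereal_def)
  show "1 \<le> Linf_norm trig"
  proof (rule dense_le)
    fix c :: ereal assume "c < 1"
    show "c \<le> Linf_norm trig"
    proof (rule ccontr)
      assume "\<not> c \<le> Linf_norm trig"
      then have "AE x in lborel. ereal (cmod (trig x)) < c"
        using esssup_AE[where M=lborel and f="\<lambda>x. ereal (cmod (trig x))"] unfolding Linf_norm_def by (auto elim!: eventually_mono)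
      define U where "U = {x. c < ereal (cmod (trig x))}"
      have "open U" unfolding U_def
        using continuous_trig by (intro open_Collect_less continuous_intros) auto
      have "0 \<in> U" using \<open>c < 1\<close> by (simp add: U_def trig_0 one_ereal_def)
      have "AE x in lborel. x \<notin> U"
        using \<open>AE x in lborel. ereal (cmod (trig x)) < c\<close> by eventually_elim (auto simp: U_def)
      then have "emeasure lborel U = 0"
        using \<open>open U\<close> AE_iff_measurable[of U lborel "\<lambda>x. x \<notin> U"] by auto
      moreover have "emeasure lborel U > 0"
      proof -
        obtain e where "0 < e" "ball 0 e \<subseteq> U" using \<open>open U\<close> \<open>0 \<in> U\<close> openE by blast
        then have "emeasure lborel (ball (0::'a) e) \<le> emeasure lborel U" using \<open>open U\<close> by (intro emeasure_mono) auto
        moreover have "0 < emeasure lborel (ball (0::'a) e)" using \<open>0 < e\<close> by (simp add: emeasure_ball)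
        ultimately show ?thesis by order
      qed
      ultimately show False by simp
    qed
  qed
qed

lemma trig_in_Linf: "trig \<in> Linf"
  unfolding Linf_def using borel_measurable_continuous_onI[OF continuous_trig] by (simp add: Linf_norm_trig)

lemma distr_support_trig: "distr_support (distr_fourier (distr_of trig)) \<subseteq> cball 0 1"
proof -
  \<comment> \<open>\<open>X\<close> collects the vectors taken with the sign +.\<close>
  define \<nu> where "\<nu> X = (1/2) *\<^sub>R ((\<Sum>v\<in>X. v) - (\<Sum>v\<in>V - X. v))" for X
  define a :: complex where "a = (1/2) ^ card V"
  have "trig = (\<lambda>x. \<Sum>X\<in>Pow V. a * iexp (x \<bullet> (2 * pi) *\<^sub>R \<nu> X))"
  proof
    fix x
    have "trig x = (\<Prod>v\<in>V. iexp (pi * (x \<bullet> v)) / 2 + iexp (- (pi * (x \<bullet> v))) / 2)"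
      unfolding trig_def cos_of_real[symmetric] cos_exp_eq by (intro prod.cong) (simp_all add: add_divide_distrib)
    also have "\<dots> = (\<Sum>X\<in>Pow V. (\<Prod>v\<in>X. iexp (pi * (x \<bullet> v)) / 2) * (\<Prod>v\<in>V - X. iexp (- (pi * (x \<bullet> v))) / 2))"
      by (rule prod_add[OF finite_V])
    also have "\<dots> = (\<Sum>X\<in>Pow V. a * iexp (x \<bullet> (2 * pi) *\<^sub>R \<nu> X))"
    proof (intro sum.cong refl)
      fix X assume "X \<in> Pow V"
      then have X: "finite X" "X \<subseteq> V" using finite_V finite_subset by auto
      have p1: "(\<Prod>v\<in>X. iexp (pi * (x \<bullet> v)) / 2) = (1/2) ^ card X * exp (\<Sum>v\<in>X. \<i> * complex_of_real (pi * (x \<bullet> v)))"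
        using X by (intro prod_exp_half)
      have p2: "(\<Prod>v\<in>V - X. iexp (- (pi * (x \<bullet> v))) / 2) = (1/2) ^ card (V - X) * exp (\<Sum>v\<in>V - X. \<i> * complex_of_real (- (pi * (x \<bullet> v))))"
        using finite_V by (intro prod_exp_half) auto
      have a: "a = (1/2) ^ card X * (1/2) ^ card (V - X)"
        unfolding a_def power_add[symmetric] using X finite_V by (simp add: card_Diff_subset card_mono)
      have e: "(\<Sum>v\<in>X. \<i> * complex_of_real (pi * (x \<bullet> v))) + (\<Sum>v\<in>V - X. \<i> * complex_of_real (- (pi * (x \<bullet> v))))
          = \<i> * complex_of_real (x \<bullet> (2 * pi) *\<^sub>R \<nu> X)"
      proof -
        have "x \<bullet> (2 * pi) *\<^sub>R \<nu> X = (\<Sum>v\<in>X. pi * (x \<bullet> v)) + (\<Sum>v\<in>V - X. - (pi * (x \<bullet> v)))"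
          by (simp add: \<nu>_def inner_diff_right inner_sum_right sum_distrib_left right_diff_distrib sum_negf)
        then show ?thesis by (simp only: of_real_add of_real_sum distrib_left sum_distrib_left)
      qed
      show "(\<Prod>v\<in>X. iexp (pi * (x \<bullet> v)) / 2) * (\<Prod>v\<in>V - X. iexp (- (pi * (x \<bullet> v))) / 2) = a * iexp (x \<bullet> (2 * pi) *\<^sub>R \<nu> X)"
        unfolding p1 p2 a e[symmetric] exp_add by (simp only: mult_ac)
    qed
    finally show "trig x = (\<Sum>X\<in>Pow V. a * iexp (x \<bullet> (2 * pi) *\<^sub>R \<nu> X))" .
  qed
  then have "distr_support (distr_fourier (distr_of trig)) \<subseteq> (\<lambda>X. - \<nu> X) ` Pow V"
    using distr_support_trig_poly[of "Pow V" "\<lambda>_. a" \<nu>] finite_V by simp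
  \<comment> \<open>The zonotope bound is tested at u = \<nu> X: twice the squared norm of \<nu> X
    is a signed sum of the v \<bullet> \<nu> X, hence at most twice the norm.\<close>
  moreover have "norm (\<nu> X) \<le> 1" if "X \<subseteq> V" for X
  proof -
    have "\<nu> X \<bullet> \<nu> X = (1/2) * ((\<Sum>v\<in>X. v \<bullet> \<nu> X) + (\<Sum>v\<in>V - X. - (v \<bullet> \<nu> X)))"
      by (subst (1) \<nu>_def) (simp add: inner_diff_left inner_sum_left sum_negf)
    also have "\<dots> \<le> (1/2) * ((\<Sum>v\<in>X. \<bar>v \<bullet> \<nu> X\<bar>) + (\<Sum>v\<in>V - X. \<bar>v \<bullet> \<nu> X\<bar>))"
      by (intro mult_left_mono add_mono sum_mono) auto
    also have "(\<Sum>v\<in>X. \<bar>v \<bullet> \<nu> X\<bar>) + (\<Sum>v\<in>V - X. \<bar>v \<bullet> \<nu> X\<bar>) = (\<Sum>v\<in>V. \<bar>v \<bullet> \<nu> X\<bar>)"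
      using sum.subset_diff[OF that finite_V, of "\<lambda>v. \<bar>v \<bullet> \<nu> X\<bar>"] by simp
    also have "(1/2) * (\<Sum>v\<in>V. \<bar>v \<bullet> \<nu> X\<bar>) \<le> norm (\<nu> X)" using zonotope[of "\<nu> X"] by simp
    finally have "norm (\<nu> X) * norm (\<nu> X) \<le> norm (\<nu> X)"
      by (simp add: power2_norm_eq_inner[symmetric] power2_eq_square)
    then show ?thesis by (cases "\<nu> X = 0") auto
  qed
  ultimately show ?thesis by force
qed

end

section \<open>Choice of the parameters\<close>

lemma exists_dense_regular_zero_set:
  fixes t :: real
  assumes dim: "DIM('b::euclidean_space) + 1 = DIM('a::euclidean_space)" and "2 \<le> DIM('a)"
    and t: "t < real DIM('a) * (unit_ball_vol (real DIM('a)) / unit_ball_vol (real DIM('b)))"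
  shows "\<exists>(f :: 'a \<Rightarrow> complex) (\<phi> :: real \<Rightarrow> real) (\<Gamma> :: 'a set).
    f \<in> Linf \<and> continuous_on UNIV f \<and> f 0 = 1 \<and> Linf_norm f = 1 \<and>
    distr_support (distr_fourier (distr_of f)) \<subseteq> cball 0 1 \<and>
    \<phi> \<in> {0..<1} \<rightarrow> {0..} \<and> continuous (at 0 within {0..<1}) \<phi> \<and> \<phi> 0 = 1 \<and>
    regular_set \<phi> \<Gamma> \<and> \<Gamma> \<subseteq> {x. f x = 0} \<and>
    enn2ereal (lower_surface_density \<Gamma>) > ereal t"
proof -
  \<comment> \<open>\<open>t\<close> may be negative, whereas densities are compared in
    \<open>ennreal\<close>.\<close>
  define t' where "t' = max t 0"
  have "t' < real DIM('a) * (unit_ball_vol (real DIM('a)) / unit_ball_vol (real DIM('b)))"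
    using t by (simp add: t'_def)
  then obtain V :: "'a set" where V: "finite V" "0 \<notin> V" "\<And>v w. v \<in> V \<Longrightarrow> w \<in> V \<Longrightarrow> v \<noteq> w \<Longrightarrow> w \<notin> span {v}"
    "\<And>u. (\<Sum>v\<in>V. \<bar>v \<bullet> u\<bar>) \<le> 2 * norm u" "t' < (\<Sum>v\<in>V. norm v)"
    using exists_direction_system[OF dim assms(2)] by metis
  define S where "S = (\<Sum>v\<in>V. norm v)"
  obtain c where c: "t' < c" "c < S" using dense V(5) S_def by blast
  have "0 \<le> t'" "0 < S" "0 \<le> c" using c by (auto simp: t'_def)
  \<comment> \<open>The second bound keeps 6 \<epsilon> S card V strictly below S - c, the part of
    the density that may be lost by cutting.\<close>
  define \<epsilon> where "\<epsilon> = min (1/2) ((S - c) / (12 * S * (real (card V) + 1)))"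
  have den: "0 < 12 * S * (real (card V) + 1)" using \<open>0 < S\<close> by simp
  have eps: "0 < \<epsilon>" "\<epsilon> \<le> 1/2" using c den by (auto simp: \<epsilon>_def)
  interpret direction_system V \<epsilon>
    using V eps by unfold_locales auto
  have "c < S * (1 - 6 * \<epsilon> * real (card V))"
  proof -
    have "\<epsilon> * (12 * S * (real (card V) + 1)) \<le> S - c"
      using den by (simp add: \<epsilon>_def min_le_iff_disj flip: pos_le_divide_eq)
    moreover have "0 < \<epsilon> * S" using eps \<open>0 < S\<close> by simp
    moreover have "0 \<le> \<epsilon> * S * real (card V)" using eps \<open>0 < S\<close> by simp
    ultimately show ?thesis by (simp add: algebra_simps)
  qed
  then have "ennreal c \<le> lower_surface_density sheets"
    using lower_surface_density_sheets[OF dim \<open>0 \<le> c\<close>] by (simp add: S_def)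
  then have "ereal c \<le> enn2ereal (lower_surface_density sheets)"
    using \<open>0 \<le> c\<close> by (simp add: less_eq_ennreal.rep_eq)
  moreover have "ereal t < ereal c" using c by (simp add: t'_def)
  ultimately have "ereal t < enn2ereal (lower_surface_density sheets)" by (rule less_le_trans[rotated])
  moreover obtain \<phi> where "\<phi> \<in> {0..<1} \<rightarrow> {0..}" "continuous (at 0 within {0..<1}) \<phi>" "\<phi> 0 = 1" "regular_set \<phi> sheets"
    using regular_sheets[OF dim] by (elim exE conjE)
  ultimately show ?thesis
    using trig_in_Linf continuous_trig trig_0 Linf_norm_trig distr_support_trig sheets_subset_zeros
    by (intro exI[of _ trig] exI[of _ \<phi>] exI[of _ sheets] conjI)
qed

text \<open>An index type with one element less, so that \<open>real ^ 'n others\<close> has dimension \<open>d - 1\<close>.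
  The second disjunct only keeps the type nonempty if \<open>'n\<close> is a singleton.\<close>

typedef 'n others = "{x::'n. x \<noteq> undefined \<or> (\<forall>y::'n. y = undefined)}"
  by blast

instance others :: (finite) finite
proof
  have "inj Rep_others" by (simp add: inj_on_def Rep_others_inject)
  then show "finite (UNIV :: 'a others set)" by (rule finite_imageD[rotated]) simp
qed

lemma CARD_others:
  assumes "CARD('n::finite) \<ge> 2"
  shows "CARD('n others) + 1 = CARD('n)"
proof -
  interpret type_definition Rep_others Abs_others "{x::'n. x \<noteq> undefined \<or> (\<forall>y::'n. y = undefined)}"
    by (rule type_definition_others)
  have "\<not> (\<forall>y::'n. y = undefined)"
  proof
    assume "\<forall>y::'n. y = undefined"
    then have "(UNIV :: 'n set) = {undefined}" by auto
    then have "CARD('n) = 1" by (metis card_1_singleton_iff One_nat_def)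
    then show False using assms by simp
  qed
  then have "{x::'n. x \<noteq> undefined \<or> (\<forall>y::'n. y = undefined)} = UNIV - {undefined}" by auto
  then have "CARD('n others) = card (UNIV - {undefined :: 'n})" using card by simp
  then show ?thesis using assms by (simp add: card_Diff_singleton)
qed

theorem theorem1p2:
  fixes \<delta> :: real
  assumes "CARD('n::finite) \<ge> 2" and "\<delta> > 0"
  shows "\<exists>(f :: real ^ 'n \<Rightarrow> complex) (\<phi> :: real \<Rightarrow> real) (\<Gamma> :: (real ^ 'n) set).
    f \<in> Linf \<and> continuous_on UNIV f \<and> f 0 = 1 \<and> Linf_norm f = 1 \<and>
    distr_support (distr_fourier (distr_of f)) \<subseteq> cball 0 1 \<and>
    \<phi> \<in> {0..<1} \<rightarrow> {0..} \<and> continuous (at 0 within {0..<1}) \<phi> \<and> \<phi> 0 = 1 \<and>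
    regular_set \<phi> \<Gamma> \<and> \<Gamma> \<subseteq> {x. f x = 0} \<and>
    enn2ereal (lower_surface_density \<Gamma>) >
      ereal (2 * (real CARD('n) / 2 *
        (unit_ball_vol (real CARD('n)) / unit_ball_vol (real (CARD('n) - 1))) - \<delta>))"
proof (rule exists_dense_regular_zero_set[where 'b="real ^ 'n others"])
  show dim: "DIM(real ^ 'n others) + 1 = DIM(real ^ 'n)" using CARD_others[OF assms(1)] by simp
  show "2 \<le> DIM(real ^ 'n)" using assms(1) by simp
  have "CARD('n) - 1 = CARD('n others)" using CARD_others[OF assms(1)] by simp
  \<comment> \<open>Expanded, the left side is the right side minus 2 \<delta>.\<close>
  then show "2 * (real CARD('n) / 2 * (unit_ball_vol (real CARD('n)) / unit_ball_vol (real (CARD('n) - 1))) - \<delta>)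
      < real DIM(real ^ 'n) * (unit_ball_vol (real DIM(real ^ 'n)) / unit_ball_vol (real DIM(real ^ 'n others)))"
    using \<open>\<delta> > 0\<close> by simp
qed

end
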